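(* Let $\alpha,\beta,\gamma,\delta,\omega_1,\omega_2\in\mathbb{C}$ with $\mathrm{Re}(\alpha),\mathrm{Re}(\beta),\mathrm{Re}(\gamma)>0$. Then $$\mathcal{L}\Big[t^{\gamma-1}E_{\alpha,\beta,\gamma}^{\delta}(\omega_1t^{\alpha},\omega_2t^{\beta})\Big](s)=\frac{1}{s^{\gamma}}\left(1-\frac{\omega_1}{s^{\alpha}}-\frac{\omega_2}{s^{\beta}}\right)^{-\delta},\qquad\mathrm{Re}(s)>0.$$
   Context: For $\alpha,\beta,\gamma,\delta\in\mathbb{C}$ with $\mathrm{Re}(\alpha)>0$, $\mathrm{Re}(\beta)>0$ and $x,y\in\mathbb{C}$, the bivariate Mittag-Leffler function is $$E_{\alpha,\beta,\gamma}^{\delta}(x,y)=\sum_{k=0}^{\infty}\sum_{l=0}^{\infty}\frac{(\delta)_{k+l}}{\Gamma(\alpha k+\beta l+\gamma)}\cdot\frac{x^ky^l}{k!\,l!}$$ (the double series converges absolutely and locally uniformly), where $(a)_n=a(a+1)\cdots(a+n-1)$, $(a)_0=1$, is the Pochhammer symbol. The Laplace transform is denoted by $\mathcal{L}[f(t)](s)=\int_0^{\infty}e^{-st}f(t)\,\mathrm{d}t$, $\mathrm{Re}(s)>0$.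
   Formalization: Proved for Re(s)>0 where the Laplace integral converges and either δ is an integer and the bracket is nonzero, or the bracket avoids (-∞,0] at all rs, r≥1 (principal powers); both shown for all large Re(s). As stated it fails: e^{2t} at s=1. *)

theory Defs
  imports "HOL-Analysis.Analysis"
begin

text \<open>
  At the poles of \<open>Gamma\<close> the library has \<open>Gamma z = 0\<close>, so that the quotient below is \<open>0\<close> there,
  in agreement with the usual reading of the entire function \<open>1 / Gamma\<close>.
\<close>

definition bivariate_mittag_leffler ::
  "complex \<Rightarrow> complex \<Rightarrow> complex \<Rightarrow> complex \<Rightarrow> complex \<Rightarrow> complex \<Rightarrow> complex" where
  "bivariate_mittag_leffler \<alpha> \<beta> \<gamma> \<delta> x y =
     (\<Sum>k. \<Sum>l. pochhammer \<delta> (k + l) / Gamma (\<alpha> * of_nat k + \<beta> * of_nat l + \<gamma>)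
              * (x ^ k * y ^ l / (fact k * fact l)))"

definition laplace_integrand :: "(real \<Rightarrow> complex) \<Rightarrow> complex \<Rightarrow> real \<Rightarrow> complex" where
  "laplace_integrand f s t = exp (- s * of_real t) * f t"

text \<open>
  The Henstock-Kurzweil integral over the half-line covers both the absolutely convergent and the
  improper (conditionally convergent) reading. It has the junk value \<open>0\<close> when the integral does
  not exist, so existence has to be stated separately.
\<close>

definition laplace :: "(real \<Rightarrow> complex) \<Rightarrow> complex \<Rightarrow> complex" where
  "laplace f s = integral {0..} (laplace_integrand f s)"

text \<open>The powers of \<open>t\<close> are principal ones; the value at the single point \<open>t = 0\<close> is irrelevant.\<close>

definition mittag_leffler_kernel ::
  "complex \<Rightarrow> complex \<Rightarrow> complex \<Rightarrow> complex \<Rightarrow> complex \<Rightarrow> complex \<Rightarrow> real \<Rightarrow> complex" where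
  "mittag_leffler_kernel \<alpha> \<beta> \<gamma> \<delta> \<omega>\<^sub>1 \<omega>\<^sub>2 t =
     of_real t powr (\<gamma> - 1) *
     bivariate_mittag_leffler \<alpha> \<beta> \<gamma> \<delta> (\<omega>\<^sub>1 * of_real t powr \<alpha>) (\<omega>\<^sub>2 * of_real t powr \<beta>)"

definition laplace_symbol ::
  "complex \<Rightarrow> complex \<Rightarrow> complex \<Rightarrow> complex \<Rightarrow> complex \<Rightarrow> complex" where
  "laplace_symbol \<alpha> \<beta> \<omega>\<^sub>1 \<omega>\<^sub>2 s = 1 - \<omega>\<^sub>1 / s powr \<alpha> - \<omega>\<^sub>2 / s powr \<beta>"

text \<open>
  The power of the symbol with exponent \<open>- \<delta>\<close> is to be the one given by the binomial series
  for large \<open>s\<close>, continued analytically. For integral \<open>\<delta>\<close> there is only one branch. Otherwise the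
  principal branch at \<open>s\<close> is the right one if no branch cut is met on the ray from infinity down
  to \<open>s\<close>; for instance this holds if the moduli of \<open>\<omega>\<^sub>1 / s powr \<alpha>\<close> and \<open>\<omega>\<^sub>2 / s powr \<beta>\<close>
  add up to less than \<open>1\<close>. Without such a condition the principal branch can be the wrong one even
  where the Laplace integral converges absolutely: for \<open>\<alpha> = 1\<close>, \<open>\<beta> = 2\<close>, \<open>\<omega>\<^sub>1 = - 2 * \<i>\<close>,
  \<open>\<omega>\<^sub>2 = 1\<close> the symbol is the square of \<open>1 + \<i> / s\<close>, and \<open>1 + \<i> / s\<close> has argument close to \<open>\<pi>\<close> if \<open>s\<close> is near
  \<open>- \<i> / 2\<close> with positive real part.
\<close>

definition symbol_power_defined ::
  "complex \<Rightarrow> complex \<Rightarrow> complex \<Rightarrow> complex \<Rightarrow> complex \<Rightarrow> complex \<Rightarrow> bool" where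
  "symbol_power_defined \<alpha> \<beta> \<delta> \<omega>\<^sub>1 \<omega>\<^sub>2 s \<longleftrightarrow>
     \<delta> \<in> \<int> \<and> laplace_symbol \<alpha> \<beta> \<omega>\<^sub>1 \<omega>\<^sub>2 s \<noteq> 0 \<or>
     (\<forall>r\<ge>1. laplace_symbol \<alpha> \<beta> \<omega>\<^sub>1 \<omega>\<^sub>2 (of_real r * s) \<notin> \<real>\<^sub>\<le>\<^sub>0)"

end

theory Submission
  imports Defs "HOL-Complex_Analysis.Complex_Analysis"
begin

text \<open>
  For large real \<open>s\<close> the Laplace transform can be taken term by term: the term with indices \<open>k\<close>, \<open>l\<close>
  of the kernel is a multiple of a power \<open>t powr (z - 1)\<close>, with \<open>z = \<alpha> * k + \<beta> * l + \<gamma>\<close>, whose transform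
  \<open>Gamma z / s powr z\<close> cancels the Gamma function in the coefficient. What is left is the binomial series of
  \<open>(1 - u - v) powr (- \<delta>)\<close> in the two variables \<open>u = \<omega>\<^sub>1 / s powr \<alpha>\<close> and \<open>v = \<omega>\<^sub>2 / s powr \<beta>\<close>
  (\<open>has_sum_bivariate_binomial\<close>). The exchange of sum and integral needs the sum of the \<open>L\<^sup>1\<close> norms, in
  which \<open>Gamma (Re z)\<close> appears instead of \<open>Gamma z\<close>. As \<open>\<alpha>\<close>, \<open>\<beta>\<close>, \<open>\<gamma>\<close> have positive real parts, all
  these \<open>z\<close> lie in one sector \<open>\<bar>Im z\<bar> \<le> C * Re z\<close>, and there the quotient \<open>Gamma (Re z) / norm (Gamma z)\<close>
  grows at most exponentially in \<open>Re z\<close> (\<open>Gamma_Re_le_norm_Gamma_sector\<close>). A large \<open>s\<close> beats this growth.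

  For the other \<open>s\<close> the integral may converge only conditionally. Let \<open>f\<close> be the kernel and \<open>G\<close> the
  indefinite integral of \<open>exp (- s * t) * f t\<close>, which is bounded because the integral converges at \<open>s\<close>.
  Integration by parts turns the Laplace transform of \<open>f\<close> at \<open>s + w\<close> into \<open>w\<close> times the one of \<open>G\<close> at \<open>w\<close>.
  The latter is absolutely convergent and holomorphic for \<open>Re w > 0\<close>, and its product with \<open>w\<close> tends to the
  limit of \<open>G\<close>, the transform at \<open>s\<close>, when \<open>w\<close> tends to \<open>0\<close> along a ray (Abel's theorem). So there is a
  holomorphic function on \<open>Re z > Re s\<close> which agrees with the formula for large real \<open>z\<close> and has the
  wanted limit at \<open>s\<close> along the ray through \<open>s\<close> (\<open>laplace_analytic_continuation\<close>). It remains to carry the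
  formula to this ray by the identity theorem. If the symbol avoids the branch cut on the ray,
  the ray and a right half-plane lie in one component of the set where the principal power is holomorphic;
  if \<open>\<delta>\<close> is an integer, clearing the denominator gives an identity between functions that are holomorphic
  on the whole half-plane.
\<close>

section \<open>The Gamma function in a sector\<close>

text \<open>
  The bound is linear in \<open>x\<close> because the summand for \<open>j = 0\<close> is \<open>1\<close> and \<open>1 / (x + j)\<^sup>2\<close> is at most the
  telescoping difference \<open>1 / (x + j - 1) - 1 / (x + j)\<close> for the others.
\<close>

lemma sum_inverse_shifted_squares_le:
  fixes x :: real
  assumes "x > 0"
  shows "(\<Sum>j\<le>n. (x / (x + real j))\<^sup>2) \<le> 1 + x"
proof -
  have "(\<Sum>j\<le>n. (x / (x + real j))\<^sup>2) \<le> 1 + x - x\<^sup>2 / (x + real n)"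
  proof (induction n)
    case 0
    show ?case using assms by (simp add: power2_eq_square)
  next
    case (Suc n)
    have "1 / ((x + real n) + 1)\<^sup>2 \<le> 1 / (x + real n) - 1 / ((x + real n) + 1)"
      using assms by (simp add: divide_simps power2_eq_square)
    from mult_left_mono[OF this, of "x\<^sup>2"]
    have "(x / (x + real (Suc n)))\<^sup>2 \<le> x\<^sup>2 / (x + real n) - x\<^sup>2 / (x + real (Suc n))"
      by (simp add: power_divide right_diff_distrib add_ac)
    then show ?case using Suc by simp
  qed
  moreover have "x\<^sup>2 / (x + real n) \<ge> 0" using assms by simp
  ultimately show ?thesis by linarith
qed

text \<open>
  Factor by factor: \<open>(norm (z + j) / (Re z + j))\<^sup>2\<close> is at most \<open>1 + (C * Re z / (Re z + j))\<^sup>2\<close>, hence at most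
  the exponential of the second summand, and the exponents add up to \<open>O (Re z)\<close> uniformly in \<open>n\<close>.
\<close>

lemma norm_pochhammer_le_sector:
  fixes z :: complex
  assumes z: "Re z > 0" and C: "\<bar>Im z\<bar> \<le> C * Re z"
  shows "norm (pochhammer z (n + 1)) \<le> exp (C\<^sup>2 / 2 * (1 + Re z)) * pochhammer (Re z) (n + 1)"
proof -
  let ?x = "Re z"
  have factor: "norm (z + of_nat j) \<le> exp (C\<^sup>2 / 2 * (?x / (?x + real j))\<^sup>2) * (?x + real j)" for j
  proof (rule power2_le_imp_le)
    let ?r = "?x + real j"
    have r: "?r > 0" using z by simp
    have "(Im z)\<^sup>2 \<le> (C * ?x)\<^sup>2" using C by (metis abs_ge_zero power2_abs power_mono)
    then have "(norm (z + of_nat j))\<^sup>2 \<le> ?r\<^sup>2 + (C * ?x)\<^sup>2" by (simp add: cmod_power2)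
    also have "\<dots> = (1 + C\<^sup>2 * (?x / ?r)\<^sup>2) * ?r\<^sup>2"
      using r by (simp add: power_divide power_mult_distrib algebra_simps)
    also have "\<dots> \<le> exp (C\<^sup>2 * (?x / ?r)\<^sup>2) * ?r\<^sup>2"
      by (intro mult_right_mono exp_ge_add_one_self) simp
    also have "\<dots> = (exp (C\<^sup>2 / 2 * (?x / ?r)\<^sup>2) * ?r)\<^sup>2"
      by (simp add: power_mult_distrib exp_double [symmetric])
    finally show "(norm (z + of_nat j))\<^sup>2 \<le> (exp (C\<^sup>2 / 2 * (?x / ?r)\<^sup>2) * ?r)\<^sup>2" .
    show "0 \<le> exp (C\<^sup>2 / 2 * (?x / ?r)\<^sup>2) * ?r" using r by simp
  qed
  have "norm (pochhammer z (n + 1)) = (\<Prod>j\<le>n. norm (z + of_nat j))"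
    by (simp add: pochhammer_Suc_prod prod_norm atLeast0AtMost)
  also have "\<dots> \<le> (\<Prod>j\<le>n. exp (C\<^sup>2 / 2 * (?x / (?x + real j))\<^sup>2) * (?x + real j))"
    by (intro prod_mono conjI factor) simp
  also have "\<dots> = exp (C\<^sup>2 / 2 * (\<Sum>j\<le>n. (?x / (?x + real j))\<^sup>2)) * pochhammer ?x (n + 1)"
    by (simp add: prod.distrib exp_sum sum_distrib_left pochhammer_Suc_prod atLeast0AtMost)
  also have "\<dots> \<le> exp (C\<^sup>2 / 2 * (1 + ?x)) * pochhammer ?x (n + 1)"
    using sum_inverse_shifted_squares_le[OF z, of n] pochhammer_pos[OF z, of "n+1"]
    by (intro mult_right_mono) (auto intro!: mult_left_mono)
  finally show ?thesis .
qed

text \<open>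
  In Euler's limit formula the numerators for \<open>z\<close> and \<open>Re z\<close> have the same modulus, so only the Pochhammer
  symbols have to be compared. A bound that is exponential in \<open>Re z\<close> is the best to expect: on a non-real
  ray Stirling's formula gives exactly this kind of decay of \<open>norm (Gamma z) / Gamma (Re z)\<close>.
\<close>

lemma Gamma_Re_le_norm_Gamma_sector:
  fixes z :: complex
  assumes z: "Re z > 0" and C: "\<bar>Im z\<bar> \<le> C * Re z"
  shows "Gamma (Re z) \<le> exp (C\<^sup>2 / 2 * (1 + Re z)) * norm (Gamma z)"
proof (rule LIMSEQ_le)
  show "Gamma_series (Re z) \<longlonglongrightarrow> Gamma (Re z)" by (rule Gamma_series_LIMSEQ)
  show "(\<lambda>n. exp (C\<^sup>2 / 2 * (1 + Re z)) * norm (Gamma_series z n))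
          \<longlonglongrightarrow> exp (C\<^sup>2 / 2 * (1 + Re z)) * norm (Gamma z)"
    by (intro tendsto_intros)
  have "Gamma_series (Re z) n \<le> exp (C\<^sup>2 / 2 * (1 + Re z)) * norm (Gamma_series z n)" for n
  proof -
    let ?p = "pochhammer z (n + 1)" and ?q = "pochhammer (Re z) (n + 1)"
    let ?E = "exp (C\<^sup>2 / 2 * (1 + Re z))" and ?a = "fact n * exp (Re z * ln (real n)) :: real"
    have q: "?q > 0" using z by (rule pochhammer_pos)
    have "z \<noteq> - of_nat k" for k using z by auto
    then have p: "norm ?p > 0" unfolding zero_less_norm_iff pochhammer_eq_0_iff by auto
    have "1 / ?q \<le> ?E / norm ?p"
      using norm_pochhammer_le_sector[OF z C, of n] p q by (simp add: divide_simps mult.commute)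
    then have "?a * (1 / ?q) \<le> ?a * (?E / norm ?p)" by (rule mult_left_mono) simp
    then show ?thesis by (simp add: Gamma_series_def norm_mult norm_divide mult_ac)
  qed
  then show "\<exists>N. \<forall>n\<ge>N. Gamma_series (Re z) n \<le> exp (C\<^sup>2 / 2 * (1 + Re z)) * norm (Gamma_series z n)"
    by blast
qed

text \<open>
  The part of the Gamma integral over \<open>{t..t + 1}\<close> is already large enough. The factor \<open>1 + 1 / t\<close>
  makes one bound serve both increasing and decreasing powers.
\<close>

lemma powr_le_Gamma:
  fixes x t :: real
  assumes "x > 0" "t > 0"
  shows "t powr (x - 1) \<le> (1 + 1 / t) * exp (t + 1) * Gamma x"
proof -
  let ?c = "t powr (x - 1) * (t / (t + 1)) / exp (t + 1)"
  have "?c \<le> u powr (x - 1) / exp u" if "u \<in> {t..t + 1}" for u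
  proof -
    have u: "u > 0" "t \<le> u" "u \<le> t + 1" using that assms by auto
    have "t powr (x - 1) * (t / (t + 1)) = t powr x / (t + 1)"
      using assms by (simp add: powr_diff)
    also have "\<dots> \<le> u powr x / u"
      using u assms by (intro frac_le powr_mono2) auto
    also have "\<dots> = u powr (x - 1)" using u by (simp add: powr_diff)
    finally show ?thesis using u by (intro frac_le) auto
  qed
  then have "integral {t..t + 1} (\<lambda>u. ?c) \<le> integral {t..t + 1} (\<lambda>u. u powr (x - 1) / exp u)"
    using assms by (intro integral_le integrable_continuous_interval continuous_intros) auto
  also have "\<dots> \<le> integral {0..} (\<lambda>u. u powr (x - 1) / exp u)"
    using Gamma_integral_real[OF assms(1)] assms
    by (intro integral_subset_le integrable_continuous_interval continuous_intros)
       (auto simp: has_integral_iff)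
  also have "\<dots> = Gamma x"
    using Gamma_integral_real[OF assms(1)] by (rule integral_unique)
  finally have "?c \<le> Gamma x" by simp
  then have "?c * ((1 + 1 / t) * exp (t + 1)) \<le> Gamma x * ((1 + 1 / t) * exp (t + 1))"
    using assms by (intro mult_right_mono) auto
  also have "?c * ((1 + 1 / t) * exp (t + 1)) = t powr (x - 1)"
    using assms by (simp add: divide_simps) 
  finally show ?thesis by (simp add: mult_ac)
qed

section \<open>Laplace transforms of powers\<close>

lemma integral_stretch_halfline:
  fixes f :: "real \<Rightarrow> complex" and c :: real
  assumes c: "c > 0" and cont: "continuous_on {0<..} f" and f: "f absolutely_integrable_on {0<..}"
  shows "(\<lambda>t. f (c * t)) absolutely_integrable_on {0<..}"
    "integral {0<..} (\<lambda>t. f (c * t)) = integral {0<..} f / of_real c"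
proof -
  define h where "h = (\<lambda>t::real. indicator {0<..} t *\<^sub>R f t)"
  define k where "k = (\<lambda>t::real. indicator {0<..} t *\<^sub>R f (c * t))"
  have "continuous_on {0<..} (\<lambda>t. f (c * t))"
    using c by (intro continuous_on_compose2[OF cont]) (auto intro!: continuous_intros)
  then have meas: "h \<in> borel_measurable lborel" "k \<in> borel_measurable lborel"
    unfolding h_def k_def using cont by (auto intro!: borel_measurable_continuous_on_indicator)
  have h: "integrable lborel h" "integral\<^sup>L lborel h = integral {0<..} f"
    using meas f set_lebesgue_integral_eq_integral(2)[OF f]
    by (simp_all add: set_integrable_def set_lebesgue_integral_def h_def integrable_completion integral_completion)
  have eq: "(\<lambda>t. h (0 + c * t)) = k"
    using c by (auto simp: h_def k_def indicator_def zero_less_mult_iff)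
  have "integrable lborel k"
    unfolding eq [symmetric] using c by (intro lborel_integrable_real_affine h(1)) simp
  then show int: "(\<lambda>t. f (c * t)) absolutely_integrable_on {0<..}"
    using meas(2) by (simp add: set_integrable_def k_def integrable_completion)
  have "integral {0<..} f = \<bar>c\<bar> *\<^sub>R integral\<^sup>L lborel k"
    unfolding h(2) [symmetric] eq [symmetric] by (rule lborel_integral_real_affine) (use c in simp)
  moreover have "integral {0<..} (\<lambda>t. f (c * t)) = integral\<^sup>L lborel k"
    using meas set_lebesgue_integral_eq_integral(2)[OF int]
    by (simp add: set_lebesgue_integral_def k_def integral_completion)
  ultimately show "integral {0<..} (\<lambda>t. f (c * t)) = integral {0<..} f / of_real c"
    using c by (simp add: scaleR_conv_of_real)
qed

lemma integral_open_halfline: "integral {0<..} f = integral {0..} f" for f :: "real \<Rightarrow> complex"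
  by (rule integral_subset_negligible) (auto intro: negligible_subset[of "{0}"])

lemma laplace_powr:
  fixes z :: complex and s :: real
  assumes z: "Re z > 0" and s: "s > 0"
  defines "f \<equiv> \<lambda>t. of_real (exp (- s * t)) * complex_of_real t powr (z - 1)"
  shows "f absolutely_integrable_on {0<..}" "integral {0<..} f = Gamma z / of_real s powr z"
proof -
  let ?g = "\<lambda>t. complex_of_real t powr (z - 1) / of_real (exp t)"
  let ?c = "complex_of_real s powr (1 - z)"
  have "continuous_on {0<..} ?g" by (auto intro!: continuous_intros)
  note stretch = integral_stretch_halfline[OF s this absolutely_integrable_Gamma_integral'[OF z]]
  have eq: "f t = ?c * ?g (s * t)" if "t \<in> {0<..}" for t
    using that s by (simp add: f_def powr_times_real powr_diff exp_minus field_simps)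
  have "(\<lambda>t. ?c * ?g (s * t)) absolutely_integrable_on {0<..}"
    using stretch(1) by (rule set_integrable_mult_right)
  also have "?this \<longleftrightarrow> f absolutely_integrable_on {0<..}"
    by (rule set_integrable_cong) (simp_all add: eq)
  finally show "f absolutely_integrable_on {0<..}" .
  have "integral {0<..} f = integral {0<..} (\<lambda>t. ?c * ?g (s * t))"
    by (rule Henstock_Kurzweil_Integration.integral_cong) (rule eq)
  also have "\<dots> = ?c * (Gamma z / of_real s)"
    unfolding integral_mult_right stretch(2) integral_unique[OF Gamma_integral_complex'[OF z]] ..
  also have "\<dots> = Gamma z / of_real s powr z"
    using s by (simp add: powr_diff)
  finally show "integral {0<..} f = Gamma z / of_real s powr z" .
qed

text \<open>
  The \<open>L\<^sup>1\<close> norm only sees \<open>Re z\<close>: the modulus of the integrand is the integrand for the exponent \<open>Re z\<close>.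
\<close>

lemma laplace_powr_lebesgue:
  fixes z :: complex and s :: real
  assumes z: "Re z > 0" and s: "s > 0"
  defines "g \<equiv> \<lambda>z t. indicator {0<..} t *\<^sub>R (of_real (exp (- s * t)) * complex_of_real t powr (z - 1))"
  shows "integrable lebesgue (g z)" "integral\<^sup>L lebesgue (g z) = Gamma z / of_real s powr z"
    "integral\<^sup>L lebesgue (\<lambda>t. norm (g z t)) = Gamma (Re z) / s powr Re z"
proof -
  have g: "integrable lebesgue (g z) \<and> integral\<^sup>L lebesgue (g z) = Gamma z / of_real s powr z"
    if "Re z > 0" for z
    using laplace_powr[OF that s] set_lebesgue_integral_eq_integral(2)[OF laplace_powr(1)[OF that s]]
    by (simp add: set_integrable_def set_lebesgue_integral_def g_def)
  then show "integrable lebesgue (g z)" "integral\<^sup>L lebesgue (g z) = Gamma z / of_real s powr z"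
    using z by auto
  have "norm (g z t) = Re (g (of_real (Re z)) t)" for t
  proof (cases "t > 0")
    case True
    have "complex_of_real t powr (of_real (Re z) - 1) = of_real (t powr (Re z - 1))"
      using True powr_of_real[of t "Re z - 1"] by simp
    then show ?thesis using True by (simp add: g_def norm_mult norm_powr_real_powr)
  qed (simp add: g_def)
  then have "integral\<^sup>L lebesgue (\<lambda>t. norm (g z t)) = Re (integral\<^sup>L lebesgue (g (of_real (Re z))))"
    using g[of "of_real (Re z)"] z by simp
  also have "\<dots> = Re (Gamma (of_real (Re z)) / of_real s powr of_real (Re z))"
    using g[of "of_real (Re z)"] z by simp
  also have "\<dots> = Gamma (Re z) / s powr Re z"
    using s by (simp add: Gamma_complex_of_real powr_of_real flip: of_real_divide)
  finally show "integral\<^sup>L lebesgue (\<lambda>t. norm (g z t)) = Gamma (Re z) / s powr Re z" .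
qed

section \<open>The binomial series in two variables\<close>

lemma norm_pochhammer_le: "norm (pochhammer \<delta> n) \<le> pochhammer (norm \<delta>) n"
  for \<delta> :: "'a :: {real_normed_field}"
proof -
  have "norm (pochhammer \<delta> n) = (\<Prod>i<n. norm (\<delta> + of_nat i))"
    by (simp add: pochhammer_prod prod_norm atLeast0LessThan)
  also have "\<dots> \<le> (\<Prod>i<n. norm \<delta> + of_nat i)"
    by (intro prod_mono conjI norm_triangle_le) auto
  finally show ?thesis by (simp add: pochhammer_prod atLeast0LessThan)
qed

lemma summable_norm_pochhammer_power:
  fixes \<delta> :: complex and r :: real
  assumes "0 \<le> r" "r < 1"
  shows "summable (\<lambda>n. norm (pochhammer \<delta> n) / fact n * r ^ n)"
proof (rule summable_comparison_test')
  \<comment> \<open>With \<open>- norm \<delta>\<close> instead of \<open>- \<delta>\<close>, and at \<open>- r\<close>, the binomial series has nonnegative terms.\<close>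
  have "(\<lambda>n. ((- norm \<delta>) gchoose n) * (- r) ^ n) sums (1 + (- r)) powr (- norm \<delta>)"
    using assms by (intro gen_binomial_real) auto
  moreover have "((- norm \<delta>) gchoose n) * (- r) ^ n = pochhammer (norm \<delta>) n / fact n * r ^ n" for n
    by (subst power_minus) (simp add: gbinomial_pochhammer)
  ultimately show "summable (\<lambda>n. pochhammer (norm \<delta>) n / fact n * r ^ n)"
    by (simp add: sums_iff)
  show "norm (norm (pochhammer \<delta> n) / fact n * r ^ n) \<le> pochhammer (norm \<delta>) n / fact n * r ^ n"
    if "n \<ge> 0" for n
    using norm_pochhammer_le[of \<delta> n] assms by (simp add: mult_right_mono divide_right_mono)
qed

text \<open>
  Summing over all pairs is the same as summing along the diagonals \<open>k + l = n\<close>, on which the Pochhammer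
  symbol is constant and the binomial theorem applies.
\<close>

lemma has_sum_diagonals:
  "((\<lambda>(k, l). f k l) has_sum S) (UNIV :: (nat \<times> nat) set) \<longleftrightarrow>
     ((\<lambda>(n, k). f k (n - k)) has_sum S) (SIGMA n:UNIV. {..n})"
  by (rule has_sum_reindex_bij_witness[where i = "\<lambda>(n, k). (k, n - k)" and j = "\<lambda>(k, l). (k + l, k)"]) auto

lemma has_sum_diagonal_binomial:
  fixes u v :: "'a :: {real_normed_field}"
  shows "((\<lambda>k. a (k + (n - k)) / (fact k * fact (n - k)) * (u ^ k * v ^ (n - k)))
            has_sum (a n / fact n * (u + v) ^ n)) {..n}"
proof (rule has_sum_finiteI)
  show "a n / fact n * (u + v) ^ n =
          (\<Sum>k\<le>n. a (k + (n - k)) / (fact k * fact (n - k)) * (u ^ k * v ^ (n - k)))"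
    unfolding binomial_ring sum_distrib_left
    by (rule sum.cong) (simp_all add: binomial_fact)
qed simp

lemma summable_bivariate_binomial_majorant:
  fixes \<delta> :: complex and p q :: real
  assumes "0 \<le> p" "0 \<le> q" "p + q < 1"
  shows "(\<lambda>(k, l). norm (pochhammer \<delta> (k + l)) / (fact k * fact l) * (p ^ k * q ^ l)) summable_on UNIV"
proof -
  have "(\<lambda>(n, k). norm (pochhammer \<delta> (k + (n - k))) / (fact k * fact (n - k)) * (p ^ k * q ^ (n - k)))
          summable_on (SIGMA n:UNIV. {..n})"
    (is "?f summable_on _")
  proof (rule summable_on_SigmaI)
    show "((\<lambda>k. ?f (n, k)) has_sum (norm (pochhammer \<delta> n) / fact n * (p + q) ^ n)) {..n}" for n
      unfolding case_prod_conv by (rule has_sum_diagonal_binomial)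
    show "(\<lambda>n. norm (pochhammer \<delta> n) / fact n * (p + q) ^ n) summable_on UNIV"
      using assms summable_norm_pochhammer_power[of "p + q" \<delta>]
      by (subst summable_on_UNIV_nonneg_real_iff) auto
    show "0 \<le> ?f (n, k)" for n k
      using assms by simp
  qed
  then show ?thesis unfolding summable_on_def has_sum_diagonals .
qed

text \<open>
  The diagonal sums are the terms of the one-variable binomial series of \<open>(1 - (u + v)) powr (- \<delta>)\<close>.
\<close>

lemma has_sum_bivariate_binomial:
  fixes \<delta> u v :: complex
  assumes uv: "norm u + norm v < 1"
  shows "((\<lambda>(k, l). pochhammer \<delta> (k + l) / (fact k * fact l) * (u ^ k * v ^ l))
            has_sum (1 - u - v) powr (- \<delta>)) UNIV"
  unfolding has_sum_diagonals
proof (rule has_sum_SigmaI)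
  let ?f = "\<lambda>(k, l). pochhammer \<delta> (k + l) / (fact k * fact l) * (u ^ k * v ^ l)"
  let ?g = "\<lambda>(n, k). pochhammer \<delta> (k + (n - k)) / (fact k * fact (n - k)) * (u ^ k * v ^ (n - k))"
  have "(\<lambda>x. norm (?f x)) summable_on UNIV"
    using summable_bivariate_binomial_majorant[OF norm_ge_zero norm_ge_zero uv, of \<delta>]
    by (simp add: case_prod_unfold norm_mult norm_divide norm_power)
  then have "?f summable_on UNIV" by (rule Infinite_Sum.abs_summable_summable)
  then show "?g summable_on (SIGMA n:UNIV. {..n})" unfolding summable_on_def has_sum_diagonals .
  show "((\<lambda>k. ?g (n, k)) has_sum (pochhammer \<delta> n / fact n * (u + v) ^ n)) {..n}" for n
    unfolding case_prod_conv by (rule has_sum_diagonal_binomial)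
  have lt1: "norm (u + v) < 1" using uv norm_triangle_ineq[of u v] by linarith
  show "((\<lambda>n. pochhammer \<delta> n / fact n * (u + v) ^ n) has_sum (1 - u - v) powr (- \<delta>)) UNIV"
  proof (rule norm_summable_imp_has_sum)
    show "summable (\<lambda>n. norm (pochhammer \<delta> n / fact n * (u + v) ^ n))"
      using summable_norm_pochhammer_power[OF norm_ge_zero lt1, of \<delta>]
      by (simp add: norm_mult norm_divide norm_power)
    have "(\<lambda>n. ((- \<delta>) gchoose n) * (- (u + v)) ^ n) sums (1 + (- (u + v))) powr (- \<delta>)"
      using lt1 by (intro gen_binomial_complex) (simp only: norm_minus_cancel)
    moreover have "((- \<delta>) gchoose n) * (- (u + v)) ^ n = pochhammer \<delta> n / fact n * (u + v) ^ n" for n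
      by (subst power_minus) (simp add: gbinomial_pochhammer)
    ultimately show "(\<lambda>n. pochhammer \<delta> n / fact n * (u + v) ^ n) sums (1 - u - v) powr (- \<delta>)"
      by (simp only: diff_conv_add_uminus minus_add_distrib add.assoc)
  qed
qed

lemma infsum_eq_suminf_suminf:
  fixes f :: "nat \<Rightarrow> nat \<Rightarrow> complex"
  assumes "(\<lambda>(k, l). f k l) summable_on UNIV"
  shows "infsum (\<lambda>(k, l). f k l) UNIV = (\<Sum>k. \<Sum>l. f k l)"
proof -
  have *: "(\<lambda>(k, l). f k l) summable_on UNIV \<times> UNIV" using assms by simp
  have inner: "(f k has_sum (\<Sum>l. f k l)) UNIV" for k
    using summable_on_SigmaD1[OF *, of k]
    by (metis UNIV_I has_sum_imp_sums has_sum_infsum sums_unique)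
  have "((\<lambda>k. \<Sum>l. f k l) has_sum infsum (\<lambda>(k, l). f k l) UNIV) UNIV"
    by (rule has_sum_SigmaD[where f = "\<lambda>(k, l). f k l" and B = "\<lambda>_. UNIV"])
       (use assms inner in auto)
  then show ?thesis by (metis has_sum_imp_sums sums_unique)
qed

lemma sums_prod_decode:
  fixes f :: "nat \<times> nat \<Rightarrow> 'a :: {topological_comm_monoid_add, t2_space}"
  assumes "(f has_sum S) UNIV"
  shows "(\<lambda>n. f (prod_decode n)) sums S"
proof (rule has_sum_imp_sums)
  show "((\<lambda>n. f (prod_decode n)) has_sum S) UNIV"
    using has_sum_reindex_bij_betw[OF bij_prod_decode, where f = f and S = S] assms by blast
qed

section \<open>The Mittag-Leffler kernel\<close>

locale mittag_leffler =
  fixes \<alpha> \<beta> \<gamma> \<delta> \<omega>\<^sub>1 \<omega>\<^sub>2 :: complex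
  assumes Re_\<alpha>: "Re \<alpha> > 0" and Re_\<beta>: "Re \<beta> > 0" and Re_\<gamma>: "Re \<gamma> > 0"
begin

abbreviation kernel :: "real \<Rightarrow> complex" where
  "kernel \<equiv> mittag_leffler_kernel \<alpha> \<beta> \<gamma> \<delta> \<omega>\<^sub>1 \<omega>\<^sub>2"

abbreviation symbol :: "complex \<Rightarrow> complex" where
  "symbol \<equiv> laplace_symbol \<alpha> \<beta> \<omega>\<^sub>1 \<omega>\<^sub>2"

definition exponent :: "nat \<Rightarrow> nat \<Rightarrow> complex" where
  "exponent k l = \<alpha> * of_nat k + \<beta> * of_nat l + \<gamma>"

definition coeff :: "nat \<Rightarrow> nat \<Rightarrow> complex" where
  "coeff k l = pochhammer \<delta> (k + l) / Gamma (exponent k l) * (\<omega>\<^sub>1 ^ k * \<omega>\<^sub>2 ^ l / (fact k * fact l))"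

text \<open>
  A slope \<open>C\<close> of a sector \<open>\<bar>Im z\<bar> \<le> C * Re z\<close> that contains \<open>\<alpha>\<close>, \<open>\<beta>\<close>, \<open>\<gamma>\<close> and therefore every exponent.
\<close>

definition aperture :: real where
  "aperture = \<bar>Im \<alpha>\<bar> / Re \<alpha> + \<bar>Im \<beta>\<bar> / Re \<beta> + \<bar>Im \<gamma>\<bar> / Re \<gamma>"

text \<open>
  The base of the exponential bound for \<open>Gamma (Re z) / norm (Gamma z)\<close> in that sector.
\<close>

definition growth :: real where
  "growth = exp (aperture\<^sup>2 / 2)"

definition ratio\<^sub>1 :: "real \<Rightarrow> real" where
  "ratio\<^sub>1 s = norm \<omega>\<^sub>1 * (growth / s) powr Re \<alpha>"

definition ratio\<^sub>2 :: "real \<Rightarrow> real" where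
  "ratio\<^sub>2 s = norm \<omega>\<^sub>2 * (growth / s) powr Re \<beta>"

text \<open>
  A bound for the \<open>L\<^sup>1\<close> norms of the terms of \<open>exp (- s * t) * kernel t\<close>: the terms of a binomial series in
  the two ratios.
\<close>

definition majorant :: "real \<Rightarrow> nat \<Rightarrow> nat \<Rightarrow> real" where
  "majorant s k l = growth * (growth / s) powr Re \<gamma> *
     (norm (pochhammer \<delta> (k + l)) / (fact k * fact l) * (ratio\<^sub>1 s ^ k * ratio\<^sub>2 s ^ l))"

definition admissible :: "real \<Rightarrow> bool" where
  "admissible s \<longleftrightarrow> s > 0 \<and> ratio\<^sub>1 s + ratio\<^sub>2 s < 1"

lemma Re_exponent: "Re (exponent k l) = Re \<alpha> * real k + Re \<beta> * real l + Re \<gamma>"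
  by (simp add: exponent_def)

lemma Re_exponent_pos: "Re (exponent k l) > 0"
  using Re_\<alpha> Re_\<beta> Re_\<gamma> by (simp add: Re_exponent add_nonneg_pos)

lemma growth_ge_1: "growth \<ge> 1"
  by (simp add: growth_def)

lemma Im_exponent_le: "\<bar>Im (exponent k l)\<bar> \<le> aperture * Re (exponent k l)"
proof -
  have part: "\<bar>Im z\<bar> \<le> aperture * Re z" if "Re z > 0" "\<bar>Im z\<bar> / Re z \<le> aperture" for z
    using that by (simp add: divide_simps)
  have "\<bar>Im \<alpha>\<bar> \<le> aperture * Re \<alpha>" "\<bar>Im \<beta>\<bar> \<le> aperture * Re \<beta>" "\<bar>Im \<gamma>\<bar> \<le> aperture * Re \<gamma>"
    by (rule part; use Re_\<alpha> Re_\<beta> Re_\<gamma> in \<open>simp add: aperture_def\<close>)+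
  then have "\<bar>Im \<alpha>\<bar> * real k + \<bar>Im \<beta>\<bar> * real l + \<bar>Im \<gamma>\<bar>
               \<le> aperture * Re \<alpha> * real k + aperture * Re \<beta> * real l + aperture * Re \<gamma>"
    by (intro add_mono mult_right_mono) auto
  moreover have "\<bar>Im (exponent k l)\<bar> \<le> \<bar>Im \<alpha>\<bar> * real k + \<bar>Im \<beta>\<bar> * real l + \<bar>Im \<gamma>\<bar>"
  proof -
    have "Im (exponent k l) = Im \<alpha> * real k + Im \<beta> * real l + Im \<gamma>" by (simp add: exponent_def)
    moreover have "\<bar>Im \<alpha> * real k\<bar> = \<bar>Im \<alpha>\<bar> * real k" "\<bar>Im \<beta> * real l\<bar> = \<bar>Im \<beta>\<bar> * real l"
      by (simp_all add: abs_mult)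
    ultimately show ?thesis by linarith
  qed
  ultimately show ?thesis by (simp add: Re_exponent algebra_simps)
qed

text \<open>
  Up to the exponential factor from the sector bound, the Gamma functions cancel. The exponential factor
  is multiplicative in the exponent and is absorbed by enlarging \<open>1 / s\<close> to \<open>growth / s\<close>.
\<close>

lemma norm_coeff_Gamma_le:
  assumes s: "s > 0"
  shows "norm (coeff k l) * Gamma (Re (exponent k l)) / s powr Re (exponent k l) \<le> majorant s k l"
proof -
  let ?z = "exponent k l"
  let ?c = "norm (pochhammer \<delta> (k + l)) * (norm \<omega>\<^sub>1 ^ k * norm \<omega>\<^sub>2 ^ l / (fact k * fact l))"
  have G: "growth > 0" using growth_ge_1 by linarith
  have "Gamma ?z \<noteq> 0" using Re_exponent_pos[of k l] by (auto simp: Gamma_eq_zero_iff elim!: nonpos_Ints_cases)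
  moreover have "growth * growth powr Re ?z = exp (aperture\<^sup>2 / 2 * (1 + Re ?z))"
    by (simp add: growth_def powr_def ring_distribs exp_add [symmetric])
  then have "Gamma (Re ?z) \<le> growth * growth powr Re ?z * norm (Gamma ?z)"
    using Gamma_Re_le_norm_Gamma_sector[OF Re_exponent_pos Im_exponent_le, of k l] by (simp only:)
  ultimately have "Gamma (Re ?z) / norm (Gamma ?z) \<le> growth * growth powr Re ?z"
    by (simp add: divide_simps)
  then have "?c / s powr Re ?z * (Gamma (Re ?z) / norm (Gamma ?z))
               \<le> ?c / s powr Re ?z * (growth * growth powr Re ?z)"
    by (rule mult_left_mono) auto
  also have "\<dots> = ?c * growth * (growth / s) powr Re ?z"
    using s G by (simp add: powr_divide)
  also have "(growth / s) powr Re ?z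
               = ((growth / s) powr Re \<alpha>) ^ k * ((growth / s) powr Re \<beta>) ^ l * (growth / s) powr Re \<gamma>"
    using s G by (simp add: Re_exponent powr_add powr_mult powr_powr [symmetric] powr_realpow)
  also have "?c * growth * \<dots> = majorant s k l"
    by (simp add: majorant_def ratio\<^sub>1_def ratio\<^sub>2_def power_mult_distrib)
  finally show ?thesis
    by (simp add: coeff_def norm_mult norm_divide norm_power mult_ac)
qed

text \<open>
  The dependence on \<open>t\<close> is separated from that on \<open>k\<close>, \<open>l\<close>, which gives uniform convergence on compact
  subsets of the open half-line.
\<close>

lemma norm_kernel_term_le:
  assumes s: "s > 0" and t: "t > 0"
  shows "norm (coeff k l * of_real t powr (exponent k l - 1))
           \<le> s * (1 + 1 / (s * t)) * exp (s * t + 1) * majorant s k l"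
proof -
  let ?z = "exponent k l"
  let ?b = "s * (1 + 1 / (s * t)) * exp (s * t + 1)"
  have "t powr (Re ?z - 1) = s / s powr Re ?z * (s * t) powr (Re ?z - 1)"
    using s t by (simp add: powr_mult powr_diff)
  also have "\<dots> \<le> s / s powr Re ?z * ((1 + 1 / (s * t)) * exp (s * t + 1) * Gamma (Re ?z))"
    using powr_le_Gamma[OF Re_exponent_pos, of "s * t" k l] s t by (intro mult_left_mono) auto
  finally have "norm (coeff k l) * t powr (Re ?z - 1)
                  \<le> norm (coeff k l) * (s / s powr Re ?z * ((1 + 1 / (s * t)) * exp (s * t + 1) * Gamma (Re ?z)))"
    by (rule mult_left_mono) simp
  also have "\<dots> = ?b * (norm (coeff k l) * Gamma (Re ?z) / s powr Re ?z)"
    by (simp add: mult_ac)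
  also have "\<dots> \<le> ?b * majorant s k l"
    using norm_coeff_Gamma_le[OF s, of k l] s t by (intro mult_left_mono) auto
  finally show ?thesis
    using t by (simp add: norm_mult norm_powr_real_powr)
qed

lemma summable_majorant:
  assumes "admissible s"
  shows "(\<lambda>(k, l). majorant s k l) summable_on UNIV"
proof -
  have "(\<lambda>(k, l). norm (pochhammer \<delta> (k + l)) / (fact k * fact l) * (ratio\<^sub>1 s ^ k * ratio\<^sub>2 s ^ l))
          summable_on UNIV"
    using assms by (intro summable_bivariate_binomial_majorant) (auto simp: admissible_def ratio\<^sub>1_def ratio\<^sub>2_def)
  from summable_on_cmult_right[OF this, of "growth * (growth / s) powr Re \<gamma>"]
  show ?thesis unfolding majorant_def case_prod_unfold .
qed

lemma eventually_admissible: "eventually admissible at_top"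
proof -
  have "((\<lambda>s. norm \<omega>\<^sub>1 * (growth powr Re \<alpha> * s powr (- Re \<alpha>)) + norm \<omega>\<^sub>2 * (growth powr Re \<beta> * s powr (- Re \<beta>)))
           \<longlongrightarrow> norm \<omega>\<^sub>1 * (growth powr Re \<alpha> * 0) + norm \<omega>\<^sub>2 * (growth powr Re \<beta> * 0)) at_top"
    by (intro tendsto_intros tendsto_neg_powr filterlim_ident) (use Re_\<alpha> Re_\<beta> in auto)
  then have "\<forall>\<^sub>F s in at_top. norm \<omega>\<^sub>1 * (growth powr Re \<alpha> * s powr (- Re \<alpha>))
               + norm \<omega>\<^sub>2 * (growth powr Re \<beta> * s powr (- Re \<beta>)) < 1"
    by (rule order_tendstoD) simp
  then show ?thesis
    using eventually_gt_at_top[of 0]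
  proof eventually_elim
    case (elim s)
    then show ?case
      using growth_ge_1 by (simp add: admissible_def ratio\<^sub>1_def ratio\<^sub>2_def powr_divide powr_minus_divide)
  qed
qed

lemma kernel_abs_summable:
  assumes t: "t > 0"
  shows "(\<lambda>(k, l). norm (coeff k l * of_real t powr (exponent k l - 1))) summable_on UNIV"
proof -
  obtain s where s: "admissible s"
    using eventually_happens'[OF trivial_limit_at_top_linorder eventually_admissible] by blast
  let ?b = "s * (1 + 1 / (s * t)) * exp (s * t + 1)"
  have "(\<lambda>x. ?b * (\<lambda>(k, l). majorant s k l) x) summable_on UNIV"
    by (rule summable_on_cmult_right[OF summable_majorant[OF s]])
  then show ?thesis
    by (rule summable_on_comparison_test)
       (use norm_kernel_term_le[of s t] s t in \<open>auto simp: admissible_def\<close>)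
qed

lemma kernel_has_sum:
  assumes t: "t > 0"
  shows "((\<lambda>(k, l). coeff k l * of_real t powr (exponent k l - 1)) has_sum kernel t) UNIV"
proof -
  let ?e = "\<lambda>k l. pochhammer \<delta> (k + l) / Gamma (\<alpha> * of_nat k + \<beta> * of_nat l + \<gamma>)
              * ((\<omega>\<^sub>1 * of_real t powr \<alpha>) ^ k * (\<omega>\<^sub>2 * of_real t powr \<beta>) ^ l / (fact k * fact l))"
  let ?f = "\<lambda>(k, l). coeff k l * of_real t powr (exponent k l - 1)"
  have pow: "complex_of_real t powr (exponent k l - 1)
          = of_real t powr (\<gamma> - 1) * (of_real t powr \<alpha>) ^ k * (of_real t powr \<beta>) ^ l" for k l
    using t by (simp add: exponent_def powr_def exp_of_nat_mult [symmetric] exp_add [symmetric] algebra_simps)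
  have term_eq: "?f = (\<lambda>x. of_real t powr (\<gamma> - 1) * (\<lambda>(k, l). ?e k l) x)"
  proof (intro ext, clarify)
    fix k l
    show "coeff k l * of_real t powr (exponent k l - 1) = of_real t powr (\<gamma> - 1) * ?e k l"
      unfolding pow exponent_def [symmetric] by (simp add: coeff_def power_mult_distrib)
  qed
  have "?f summable_on UNIV"
    by (rule Infinite_Sum.abs_summable_summable)
       (use kernel_abs_summable[OF t] in \<open>simp add: case_prod_unfold\<close>)
  then have sum: "(?f has_sum infsum ?f UNIV) UNIV" by simp
  then have "(\<lambda>(k, l). ?e k l) summable_on UNIV"
    using \<open>?f summable_on UNIV\<close> t unfolding term_eq by (subst (asm) summable_on_cmult_right') auto
  then have "infsum ?f UNIV = kernel t"
    unfolding term_eq infsum_cmult_right'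
    by (subst infsum_eq_suminf_suminf) (simp_all add: mittag_leffler_kernel_def bivariate_mittag_leffler_def)
  with sum show ?thesis by simp
qed

lemma continuous_on_kernel: "continuous_on {0<..} kernel"
proof (rule continuous_at_imp_continuous_on, rule ballI)
  fix t\<^sub>0 :: real
  assume t0: "t\<^sub>0 \<in> {0<..}"
  obtain s where s: "admissible s"
    using eventually_happens'[OF trivial_limit_at_top_linorder eventually_admissible] by blast
  then have s0: "s > 0" by (simp add: admissible_def)
  let ?I = "{t\<^sub>0 / 2<..<t\<^sub>0 + 1}"
  let ?b = "s * (1 + 1 / (s * (t\<^sub>0 / 2))) * exp (s * (t\<^sub>0 + 1) + 1)"
  let ?f = "\<lambda>(k, l) t. coeff k l * of_real t powr (exponent k l - 1)"
  have maj: "majorant s k l \<ge> 0" for k l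
    using growth_ge_1 by (simp add: majorant_def ratio\<^sub>1_def ratio\<^sub>2_def)
  have "uniform_limit ?I (\<lambda>X t. \<Sum>x\<in>X. ?f x t) kernel (finite_subsets_at_top UNIV)"
  proof (rule Weierstrass_m_test_general')
    show "(\<lambda>x. ?b * (\<lambda>(k, l). majorant s k l) x) summable_on UNIV"
      by (rule summable_on_cmult_right[OF summable_majorant[OF s]])
    show "((\<lambda>x. ?f x t) has_sum kernel t) UNIV" if "t \<in> ?I" for t
      using kernel_has_sum[of t] that t0 by (simp add: case_prod_unfold)
    show "norm (?f x t) \<le> ?b * (\<lambda>(k, l). majorant s k l) x" if "t \<in> ?I" for x t
    proof (cases x)
      case (Pair k l)
      have t: "t > 0" "t\<^sub>0 / 2 \<le> t" "t \<le> t\<^sub>0 + 1" using that t0 by auto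
      have "s * (1 + 1 / (s * t)) * exp (s * t + 1) * majorant s k l \<le> ?b * majorant s k l"
        using t t0 s0 maj by (intro mult_mono add_mono divide_left_mono) auto
      then show ?thesis
        using norm_kernel_term_le[OF s0 t(1), of k l] Pair by simp
    qed
  qed
  then have "continuous_on ?I kernel"
    by (rule uniform_limit_theorem [rotated])
       (use t0 in \<open>auto simp: case_prod_unfold intro!: always_eventually continuous_intros\<close>)
  then show "isCont kernel t\<^sub>0"
    using t0 by (simp add: continuous_on_eq_continuous_at)
qed

end

section \<open>The transform for large real arguments\<close>

context mittag_leffler
begin

lemma norm_symbol_terms_lt_1:
  assumes s: "admissible s"
  shows "norm (\<omega>\<^sub>1 / of_real s powr \<alpha>) + norm (\<omega>\<^sub>2 / of_real s powr \<beta>) < 1"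
proof -
  have s0: "s > 0" using s by (simp add: admissible_def)
  have "inverse (s powr a) \<le> (growth / s) powr a" if "a > 0" for a
    using that s0 growth_ge_1 powr_mono2[of a "1 / s" "growth / s"]
    by (simp add: powr_divide divide_right_mono inverse_eq_divide)
  then have "norm \<omega>\<^sub>1 * inverse (s powr Re \<alpha>) + norm \<omega>\<^sub>2 * inverse (s powr Re \<beta>) \<le> ratio\<^sub>1 s + ratio\<^sub>2 s"
    unfolding ratio\<^sub>1_def ratio\<^sub>2_def using Re_\<alpha> Re_\<beta> by (intro add_mono mult_left_mono) auto
  also have "\<dots> < 1" using s by (simp add: admissible_def)
  finally show ?thesis using s0 by (simp add: norm_mult norm_inverse norm_powr_real_powr divide_inverse)
qed

text \<open>
  Term-by-term integration: the \<open>L\<^sup>1\<close> norms of the terms are dominated by the summable majorant.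
\<close>

lemma laplace_kernel_admissible:
  assumes s: "admissible s"
  defines "f \<equiv> \<lambda>t. of_real (exp (- s * t)) * kernel t"
  shows "f absolutely_integrable_on {0<..}"
    "integral {0<..} f = 1 / of_real s powr \<gamma> * symbol (of_real s) powr (- \<delta>)"
proof -
  have s0: "s > 0" using s by (simp add: admissible_def)
  define g where "g = (\<lambda>z t. indicator {0<..} t *\<^sub>R (of_real (exp (- s * t)) * complex_of_real t powr (z - 1)))"
  define F where "F = (\<lambda>(k, l) t. coeff k l * g (exponent k l) t)"
  define h where "h = (\<lambda>n. F (prod_decode n))"
  have g_facts: "integrable lebesgue (g (exponent k l))"
      "integral\<^sup>L lebesgue (g (exponent k l)) = Gamma (exponent k l) / of_real s powr exponent k l"
      "integral\<^sup>L lebesgue (\<lambda>t. norm (g (exponent k l) t)) = Gamma (Re (exponent k l)) / s powr Re (exponent k l)"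
    for k l
    unfolding g_def by (rule laplace_powr_lebesgue[OF Re_exponent_pos s0])+
  let ?u = "\<omega>\<^sub>1 / of_real s powr \<alpha>" and ?v = "\<omega>\<^sub>2 / of_real s powr \<beta>"
  have F_integrable: "integrable lebesgue (F x)" for x
    using g_facts(1) by (cases x) (simp add: F_def)
  have F_norm: "(\<integral>t. norm (F (k, l) t) \<partial>lebesgue) \<le> majorant s k l" for k l
    using norm_coeff_Gamma_le[OF s0, of k l] g_facts(3) by (simp add: F_def norm_mult)
  have F_integral: "integral\<^sup>L lebesgue (F (k, l)) = 1 / of_real s powr \<gamma> *
      (pochhammer \<delta> (k + l) / (fact k * fact l) * (?u ^ k * ?v ^ l))" for k l
  proof -
    have "complex_of_real s powr exponent k l = (of_real s powr \<alpha>) ^ k * (of_real s powr \<beta>) ^ l * of_real s powr \<gamma>"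
      using s0 by (simp add: exponent_def powr_def exp_of_nat_mult [symmetric] exp_add [symmetric] algebra_simps)
    moreover have "Gamma (exponent k l) \<noteq> 0"
      using Re_exponent_pos[of k l] by (auto simp: Gamma_eq_zero_iff elim!: nonpos_Ints_cases)
    ultimately show ?thesis
      using g_facts(2) by (simp add: F_def coeff_def power_divide)
  qed
  have F_sum: "((\<lambda>x. F x t) has_sum (indicator {0<..} t *\<^sub>R f t)) UNIV" for t
  proof (cases "t > 0")
    case True
    have "((\<lambda>x. of_real (exp (- s * t)) * (\<lambda>(k, l). coeff k l * of_real t powr (exponent k l - 1)) x)
            has_sum f t) UNIV"
      unfolding f_def by (rule has_sum_cmult_right[OF kernel_has_sum[OF True]])
    then show ?thesis using True by (simp add: F_def g_def case_prod_unfold mult_ac)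
  qed (simp add: F_def g_def case_prod_unfold)
  have F_abs_sum: "(\<lambda>x. norm (F x t)) summable_on UNIV" for t
  proof (cases "t > 0")
    case True
    have "(\<lambda>x. exp (- s * t) * (\<lambda>(k, l). norm (coeff k l * of_real t powr (exponent k l - 1))) x) summable_on UNIV"
      by (rule summable_on_cmult_right[OF kernel_abs_summable[OF True]])
    then show ?thesis using True by (simp add: F_def g_def case_prod_unfold norm_mult mult_ac)
  qed (simp add: F_def g_def case_prod_unfold)
  have h_sum: "(\<lambda>n. h n t) sums (indicator {0<..} t *\<^sub>R f t)" for t
    unfolding h_def using F_sum by (rule sums_prod_decode)
  have h_integrable: "integrable lebesgue (h n)" for n
    by (simp add: h_def F_integrable)
  have h_abs_sum: "AE t in lebesgue. summable (\<lambda>n. norm (h n t))"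
  proof (rule AE_I2)
    fix t
    show "summable (\<lambda>n. norm (h n t))"
      unfolding h_def using sums_prod_decode[OF has_sum_infsum[OF F_abs_sum[of t]]] by (rule sums_summable)
  qed
  have h_norm_sum: "summable (\<lambda>n. \<integral>t. norm (h n t) \<partial>lebesgue)"
  proof (rule summable_comparison_test')
    show "summable (\<lambda>n. (\<lambda>(k, l). majorant s k l) (prod_decode n))"
      using sums_prod_decode[OF has_sum_infsum[OF summable_majorant[OF s]]] by (rule sums_summable)
    show "norm (\<integral>t. norm (h n t) \<partial>lebesgue) \<le> (\<lambda>(k, l). majorant s k l) (prod_decode n)" if "n \<ge> 0" for n
      using F_norm by (cases "prod_decode n") (simp add: h_def)
  qed
  have "integrable lebesgue (\<lambda>t. \<Sum>n. h n t)"
    by (rule integrable_suminf[OF h_integrable h_abs_sum h_norm_sum])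
  then show f: "f absolutely_integrable_on {0<..}"
    by (simp add: set_integrable_def sums_unique[OF h_sum, symmetric])
  have "((\<lambda>x. 1 / of_real s powr \<gamma> * (\<lambda>(k, l). pochhammer \<delta> (k + l) / (fact k * fact l) * (?u ^ k * ?v ^ l)) x)
          has_sum (1 / of_real s powr \<gamma> * (1 - ?u - ?v) powr (- \<delta>))) UNIV"
    by (rule has_sum_cmult_right[OF has_sum_bivariate_binomial[OF norm_symbol_terms_lt_1[OF s]]])
  then have "((\<lambda>x. integral\<^sup>L lebesgue (F x)) has_sum (1 / of_real s powr \<gamma> * (1 - ?u - ?v) powr (- \<delta>))) UNIV"
    by (rule has_sum_cong[THEN iffD2, rotated]) (simp add: F_integral split: prod.split)
  then have "(\<lambda>n. integral\<^sup>L lebesgue (h n)) sums (1 / of_real s powr \<gamma> * (1 - ?u - ?v) powr (- \<delta>))"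
    unfolding h_def by (rule sums_prod_decode)
  moreover have "(\<lambda>n. integral\<^sup>L lebesgue (h n)) sums (\<integral>t. (\<Sum>n. h n t) \<partial>lebesgue)"
    by (rule sums_integral[OF h_integrable h_abs_sum h_norm_sum])
  moreover have "(\<integral>t. (\<Sum>n. h n t) \<partial>lebesgue) = integral {0<..} f"
    using set_lebesgue_integral_eq_integral(2)[OF f]
    by (simp add: set_lebesgue_integral_def sums_unique[OF h_sum, symmetric])
  ultimately show "integral {0<..} f = 1 / of_real s powr \<gamma> * symbol (of_real s) powr (- \<delta>)"
    by (simp add: laplace_symbol_def sums_iff)
qed

end

section \<open>Conditionally convergent Laplace integrals\<close>

text \<open>
  The gauge integral over the half-line is always an improper integral, even if it is not absolutely
  convergent.
\<close>

lemma integral_initial_segments_tendsto: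
  fixes f :: "real \<Rightarrow> complex"
  assumes "f integrable_on {0..}"
  shows "((\<lambda>T. integral {0..T} f) \<longlongrightarrow> integral {0..} f) at_top"
proof (rule tendstoI)
  fix e :: real
  assume "e > 0"
  let ?f = "\<lambda>x. if x \<in> {0..} then f x else 0"
  have "\<exists>B>0. \<forall>a b. ball 0 B \<subseteq> cbox a b \<longrightarrow> norm (integral (cbox a b) ?f - integral {0..} f) < e"
    using integrable_integral[OF assms] \<open>e > 0\<close> by (subst (asm) has_integral_alt') blast
  then obtain B where B: "B > 0"
    and close: "\<And>a b. ball 0 B \<subseteq> cbox a b \<Longrightarrow> norm (integral (cbox a b) ?f - integral {0..} f) < e"
    by blast
  have "dist (integral {0..T} f) (integral {0..} f) < e" if "T \<ge> B" for T
  proof -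
    have "integral (cbox (- T) T) ?f = integral ({0..} \<inter> cbox (- T) T) f"
      by (rule integral_restrict_Int)
    also have "{0..} \<inter> cbox (- T) T = {0..T}" using that B by auto
    finally have "integral (cbox (- T) T) ?f = integral {0..T} f" .
    moreover have "ball 0 B \<subseteq> cbox (- T) T" using that by (auto simp: dist_real_def)
    ultimately show ?thesis using close[of "- T" T] by (simp add: dist_norm)
  qed
  then show "\<forall>\<^sub>F T in at_top. dist (integral {0..T} f) (integral {0..} f) < e"
    by (rule eventually_at_top_linorderI)
qed

lemma has_vector_derivative_exp_minus:
  "((\<lambda>u. exp (- z * complex_of_real u)) has_vector_derivative - z * exp (- z * of_real u)) (at u within S)"
  by (rule has_vector_derivative_real_field[where f = "\<lambda>w. exp (- z * w)"])
     (auto intro!: derivative_eq_intros)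

lemma laplace_bounded:
  fixes G :: "real \<Rightarrow> complex"
  assumes cont: "continuous_on {0..} G" and bound: "\<And>t. t \<ge> 0 \<Longrightarrow> norm (G t) \<le> M" and z: "Re z > 0"
  shows "(\<lambda>u. exp (- z * of_real u) * G u) absolutely_integrable_on {0..}"
proof (rule measurable_bounded_by_integrable_imp_absolutely_integrable)
  show "(\<lambda>u. exp (- z * of_real u) * G u) \<in> borel_measurable (lebesgue_on {0..})"
    by (intro continuous_imp_measurable_on_sets_lebesgue continuous_intros cont) auto
  show "(\<lambda>u. exp (- Re z * u) * M) integrable_on {0..}"
    using integrable_on_exp_minus_to_infinity[OF z, of 0] by (intro integrable_on_mult_left)
  show "norm (exp (- z * of_real u) * G u) \<le> exp (- Re z * u) * M" if "u \<in> {0..}" for u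
    using bound[of u] that by (simp add: norm_mult)
qed simp

text \<open>
  The integrals over \<open>{0..n}\<close> are holomorphic by differentiation under the integral sign. Their tails are
  \<open>O (exp (- Re x / 2 * n))\<close> uniformly for \<open>z\<close> in the disc of radius \<open>Re x / 2\<close> about \<open>x\<close>.
\<close>

lemma holomorphic_laplace_bounded:
  fixes G :: "real \<Rightarrow> complex"
  assumes cont: "continuous_on {0..} G" and bound: "\<And>t. t \<ge> 0 \<Longrightarrow> norm (G t) \<le> M"
  shows "(\<lambda>z. integral {0..} (\<lambda>u. exp (- z * of_real u) * G u)) holomorphic_on {z. Re z > 0}"
proof (rule holomorphic_uniform_sequence)
  show "open {z. Re z > 0}" by (rule open_halfspace_Re_gt)
  let ?K = "\<lambda>z. integral {0..} (\<lambda>u. exp (- z * of_real u) * G u)"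
  let ?Kn = "\<lambda>n z. integral {0..real n} (\<lambda>u. exp (- z * of_real u) * G u)"
  show "?Kn n holomorphic_on {z. Re z > 0}" for n
    unfolding cbox_interval [symmetric]
  proof (rule leibniz_rule_holomorphic)
    show "((\<lambda>z. exp (- z * of_real u) * G u) has_field_derivative (- of_real u * exp (- z * of_real u) * G u))
            (at z within {z. Re z > 0})" for z u
      by (auto intro!: derivative_eq_intros)
    show "(\<lambda>u. exp (- z * of_real u) * G u) integrable_on cbox 0 (real n)" for z
      using cont by (intro integrable_continuous continuous_intros) (auto elim: continuous_on_subset)
    have "continuous_on ({z. Re z > 0} \<times> cbox 0 (real n)) (\<lambda>x. G (snd x))"
      by (rule continuous_on_compose2[OF cont]) (auto intro: continuous_intros)
    then show "continuous_on ({z. Re z > 0} \<times> cbox 0 (real n)) (\<lambda>(z, u). - of_real u * exp (- z * of_real u) * G u)"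
      unfolding case_prod_unfold by (intro continuous_intros)
    show "convex {z. Re z > 0}" by (rule convex_halfspace_Re_gt)
  qed
  show "\<exists>d>0. cball x d \<subseteq> {z. Re z > 0} \<and> uniform_limit (cball x d) ?Kn ?K sequentially"
    if "x \<in> {z. Re z > 0}" for x
  proof (intro exI conjI)
    let ?r = "Re x / 2"
    show "?r > 0" using that by simp
    have Re_ge: "Re z \<ge> ?r" if "z \<in> cball x ?r" for z
      using that abs_Re_le_cmod[of "x - z"] by (auto simp: dist_norm)
    then show "cball x ?r \<subseteq> {z. Re z > 0}" using \<open>?r > 0\<close> by force
    show "uniform_limit (cball x ?r) ?Kn ?K sequentially"
    proof (rule uniform_limitI)
      fix e :: real assume "e > 0"
      have tail: "dist (?Kn n z) (?K z) \<le> \<bar>M\<bar> * (exp (- ?r * real n) / ?r)" if "z \<in> cball x ?r" for n z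
      proof -
        let ?g = "\<lambda>u. exp (- z * of_real u) * G u"
        have z: "Re z > 0" using Re_ge[OF that] \<open>?r > 0\<close> by linarith
        have int: "?g integrable_on {0..}"
          using laplace_bounded[OF cont bound z] by (rule set_lebesgue_integral_eq_integral(1))
        have int1: "?g integrable_on {0..real n}" 
          using cont by (intro integrable_continuous_interval continuous_intros) (auto elim: continuous_on_subset)
        have int2: "?g integrable_on {real n..}" 
          by (rule set_lebesgue_integral_eq_integral(1), rule set_integrable_subset[OF laplace_bounded[OF cont bound z]]) auto
        have "?K z = ?Kn n z + integral {real n..} ?g"
        proof -
          have "(?g has_integral (?Kn n z + integral {real n..} ?g)) ({0..real n} \<union> {real n..})"
            using int1 int2 by (intro has_integral_Un integrable_integral) (auto intro: negligible_subset[of "{real n}"])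
          moreover have "{0..real n} \<union> {real n..} = {0..}" by auto
          ultimately show ?thesis by (simp add: integral_unique)
        qed
        then have "dist (?Kn n z) (?K z) = norm (integral {real n..} ?g)" by (simp add: dist_norm)
        also have "\<dots> \<le> integral {real n..} (\<lambda>u. \<bar>M\<bar> * exp (- ?r * u))"
        proof (rule integral_norm_bound_integral[OF int2])
          show "(\<lambda>u. \<bar>M\<bar> * exp (- ?r * u)) integrable_on {real n..}"
            by (intro integrable_on_mult_right integrable_on_exp_minus_to_infinity \<open>?r > 0\<close>)
          fix u assume u: "u \<in> {real n..}"
          then have "norm (G u) \<le> \<bar>M\<bar>" using bound[of u] by auto
          moreover have "exp (- Re z * u) \<le> exp (- ?r * u)"
            using mult_right_mono[OF Re_ge[OF that], of u] u by simp
          ultimately show "norm (?g u) \<le> \<bar>M\<bar> * exp (- ?r * u)"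
            by (simp add: norm_mult mult.commute mult_mono)
        qed
        also have "\<dots> = \<bar>M\<bar> * (exp (- ?r * real n) / ?r)"
          using has_integral_exp_minus_to_infinity[OF \<open>?r > 0\<close>, of "real n"]
          by (simp only: integral_mult_right integral_unique)
        finally show ?thesis .
      qed
      have "(\<lambda>n. \<bar>M\<bar> * (exp (- ?r * real n) / ?r)) \<longlonglongrightarrow> \<bar>M\<bar> * (0 / ?r)"
        using \<open>?r > 0\<close>
        by (intro tendsto_intros filterlim_compose[OF exp_at_bot]
              filterlim_tendsto_neg_mult_at_bot[OF tendsto_const] filterlim_real_sequentially) auto
      then have "\<forall>\<^sub>F n in sequentially. \<bar>M\<bar> * (exp (- ?r * real n) / ?r) < e"
        using \<open>e > 0\<close> by (intro order_tendstoD(2)) auto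
      then show "\<forall>\<^sub>F n in sequentially. \<forall>z\<in>cball x ?r. dist (?Kn n z) (?K z) < e"
        by eventually_elim (use tail in \<open>blast intro: le_less_trans\<close>)
    qed
  qed
qed

lemma integral_exp_minus_complex:
  assumes s: "Re s > 0"
  shows "integral {0..} (\<lambda>v. s * exp (- s * complex_of_real v)) = 1"
proof -
  let ?g = "\<lambda>v. s * exp (- s * complex_of_real v)"
  have "(\<lambda>v. exp (- s * of_real v) * s) absolutely_integrable_on {0..}"
    using s by (intro laplace_bounded[where M = "norm s"]) auto
  then have "?g integrable_on {0..}"
    unfolding mult.commute[of s] by (rule set_lebesgue_integral_eq_integral(1))
  then have 1: "((\<lambda>T. integral {0..T} ?g) \<longlongrightarrow> integral {0..} ?g) at_top"
    by (rule integral_initial_segments_tendsto)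
  have 2: "\<forall>\<^sub>F T in at_top. integral {0..T} ?g = 1 - exp (- s * of_real T)"
  proof (rule eventually_at_top_linorderI)
    fix T :: real assume "0 \<le> T"
    have "((\<lambda>u. - exp (- s * complex_of_real u)) has_vector_derivative ?g u) (at u within {0..T})" for u
      using has_vector_derivative_minus[OF has_vector_derivative_exp_minus[of s u "{0..T}"]] by simp
    with \<open>0 \<le> T\<close> have "(?g has_integral (- exp (- s * of_real T) - (- exp (- s * of_real 0)))) {0..T}"
      by (intro fundamental_theorem_of_calculus) auto
    from integral_unique[OF this] show "integral {0..T} ?g = 1 - exp (- s * of_real T)" by simp
  qed
  have "((\<lambda>T. exp (- Re s * T)) \<longlongrightarrow> 0) at_top"
    using s by (intro filterlim_compose[OF exp_at_bot]
          filterlim_tendsto_neg_mult_at_bot[OF tendsto_const] filterlim_ident) auto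
  then have "((\<lambda>T. norm (exp (- s * complex_of_real T))) \<longlongrightarrow> 0) at_top" by simp
  then have "((\<lambda>T. exp (- s * complex_of_real T)) \<longlongrightarrow> 0) at_top"
    by (rule tendsto_norm_zero_cancel)
  then have "((\<lambda>T. 1 - exp (- s * complex_of_real T)) \<longlongrightarrow> 1 - 0) at_top"
    by (intro tendsto_diff tendsto_const)
  then have "((\<lambda>T. integral {0..T} ?g) \<longlongrightarrow> 1 - 0) at_top"
    unfolding tendsto_cong[OF 2] .
  from tendsto_unique[OF trivial_limit_at_top_linorder 1 this] show ?thesis by simp
qed

text \<open>
  Substituting \<open>u = r * v\<close> moves the parameter \<open>r\<close> from the exponential into the argument of \<open>G\<close>, so that a
  limit for large \<open>r\<close> becomes a matter of dominated convergence.
\<close>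

lemma laplace_bounded_rescaled:
  fixes G :: "real \<Rightarrow> complex"
  assumes cont: "continuous_on {0..} G" and bound: "\<And>t. t \<ge> 0 \<Longrightarrow> norm (G t) \<le> M"
    and s: "Re s > 0" and r: "r > 0"
  shows "(\<lambda>v. s * exp (- s * of_real v) * G (r * v)) absolutely_integrable_on {0<..}"
    "integral {0<..} (\<lambda>v. s * exp (- s * of_real v) * G (r * v)) =
       s / of_real r * integral {0..} (\<lambda>u. exp (- (s / of_real r) * of_real u) * G u)"
proof -
  let ?w = "s / of_real r"
  let ?f = "\<lambda>u. exp (- ?w * of_real u) * G u"
  have w: "Re ?w > 0" using s r by (simp add: Re_divide_of_real)
  have f: "?f absolutely_integrable_on {0<..}"
    by (rule set_integrable_subset[OF laplace_bounded[OF cont bound w]]) auto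
  have contf: "continuous_on {0<..} ?f"
    using cont r by (intro continuous_intros) (auto elim: continuous_on_subset)
  have eq: "(\<lambda>v. s * exp (- s * of_real v) * G (r * v)) = (\<lambda>v. s * ?f (r * v))"
    using r by (simp add: fun_eq_iff)
  note stretch = integral_stretch_halfline[OF r contf f]
  show "(\<lambda>v. s * exp (- s * of_real v) * G (r * v)) absolutely_integrable_on {0<..}"
    unfolding eq using stretch(1) by (rule set_integrable_mult_right)
  show "integral {0<..} (\<lambda>v. s * exp (- s * of_real v) * G (r * v)) = ?w * integral {0..} ?f"
    unfolding eq integral_mult_right stretch(2) integral_open_halfline by simp
qed

text \<open>
  Abel's theorem along the ray through \<open>s\<close>: after rescaling, \<open>G (r * v)\<close> tends to \<open>L\<close> for each \<open>v > 0\<close>, and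
  the total weight of \<open>s * exp (- s * v)\<close> is \<open>1\<close>.
\<close>

lemma abel_limit_laplace:
  fixes G :: "real \<Rightarrow> complex"
  assumes cont: "continuous_on {0..} G" and bound: "\<And>t. t \<ge> 0 \<Longrightarrow> norm (G t) \<le> M"
    and lim: "(G \<longlongrightarrow> L) at_top" and s: "Re s > 0"
  shows "(\<lambda>n. s / of_real (real (Suc n)) *
            integral {0..} (\<lambda>u. exp (- (s / of_real (real (Suc n))) * of_real u) * G u)) \<longlonglongrightarrow> L"
proof -
  let ?h = "\<lambda>n v. s * exp (- s * of_real v) * G (real (Suc n) * v)"
  have pos: "real (Suc n) > 0" for n by simp
  have rescaled: "?h n absolutely_integrable_on {0<..}"
    "integral {0<..} (?h n) = s / of_real (real (Suc n)) *
       integral {0..} (\<lambda>u. exp (- (s / of_real (real (Suc n))) * of_real u) * G u)" for n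
    using laplace_bounded_rescaled[OF cont bound s pos[of n]] by blast+
  have exp_integrable: "(\<lambda>v. s * exp (- s * of_real v) * of_real M) absolutely_integrable_on {0<..}"
    by (rule laplace_bounded_rescaled(1)[where r = 1 and G = "\<lambda>_. of_real M" and M = "norm (complex_of_real M)"])
       (use s in auto)
  have "(\<lambda>n. integral {0<..} (?h n)) \<longlonglongrightarrow> integral {0<..} (\<lambda>v. s * exp (- s * of_real v) * L)"
  proof (rule dominated_convergence)
    show "?h n integrable_on {0<..}" for n
      using rescaled(1) by (rule set_lebesgue_integral_eq_integral(1))
    show "(\<lambda>v. norm (s * exp (- s * of_real v) * of_real M)) integrable_on {0<..}"
      using exp_integrable unfolding absolutely_integrable_on_def by blast
    show "norm (?h n v) \<le> norm (s * exp (- s * of_real v) * of_real M)" if "v \<in> {0<..}" for n v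
    proof -
      have "norm (G (real (Suc n) * v)) \<le> norm (complex_of_real M)"
        using bound[of "real (Suc n) * v"] that by (simp add: order_trans[OF _ abs_ge_self] del: of_nat_Suc)
      then show ?thesis unfolding norm_mult by (rule mult_left_mono) simp
    qed
    show "(\<lambda>n. ?h n v) \<longlonglongrightarrow> s * exp (- s * of_real v) * L" if "v \<in> {0<..}" for v
    proof -
      have "filterlim (\<lambda>n. v * real (Suc n)) at_top sequentially"
        using that by (intro filterlim_tendsto_pos_mult_at_top[OF tendsto_const]
              filterlim_compose[OF filterlim_real_sequentially filterlim_Suc]) auto
      then have "filterlim (\<lambda>n. real (Suc n) * v) at_top sequentially"
        unfolding mult.commute[of v] .
      then have "(\<lambda>n. G (real (Suc n) * v)) \<longlonglongrightarrow> L" by (rule filterlim_compose[OF lim])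
      then show ?thesis by (rule tendsto_mult_left)
    qed
  qed
  moreover have "integral {0<..} (\<lambda>v. s * exp (- s * of_real v) * L) = L"
    unfolding integral_open_halfline integral_mult_left integral_exp_minus_complex[OF s] by simp
  ultimately show ?thesis by (simp only: rescaled(2))
qed

lemma continuous_on_indefinite_integral_halfline:
  fixes g :: "real \<Rightarrow> complex"
  assumes int: "\<And>T. g integrable_on {0..T}"
  shows "continuous_on {0..} (\<lambda>t. integral {0..t} g)"
  unfolding continuous_on_eq_continuous_within
proof
  fix t :: real
  assume t: "t \<in> {0..}"
  have "continuous (at t within {0..t + 1}) (\<lambda>t. integral {0..t} g)"
    using indefinite_integral_continuous_1[OF int[of "t + 1"]] t
    by (simp add: continuous_on_eq_continuous_within)
  moreover have "at t within {0..t + 1} = at t within {0..}"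
    by (rule at_within_nhd[where S = "{..<t + 1}"]) auto
  ultimately show "continuous (at t within {0..}) (\<lambda>t. integral {0..t} g)" by simp
qed

text \<open>
  The integrand may be singular at \<open>0\<close>, where \<open>G\<close> is still continuous; the fundamental theorem of calculus
  for functions that are differentiable in the interior covers this. The boundary term at infinity vanishes
  because \<open>G\<close> is bounded.
\<close>

lemma laplace_by_parts:
  fixes g G :: "real \<Rightarrow> complex"
  assumes cont: "continuous_on {0<..} g" and int: "\<And>T. g integrable_on {0..T}"
  defines "G \<equiv> \<lambda>t. integral {0..t} g"
  assumes bound: "\<And>t. t \<ge> 0 \<Longrightarrow> norm (G t) \<le> M" and z: "Re z > 0"
    and zint: "(\<lambda>u. exp (- z * of_real u) * g u) integrable_on {0..}"
  shows "integral {0..} (\<lambda>u. exp (- z * of_real u) * g u) = z * integral {0..} (\<lambda>u. exp (- z * of_real u) * G u)"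
proof -
  let ?e = "\<lambda>u. exp (- z * complex_of_real u)"
  have contG: "continuous_on {0..} G"
    unfolding G_def using int by (rule continuous_on_indefinite_integral_halfline)
  have derG: "(G has_vector_derivative g u) (at u)" if "u > 0" for u
  proof -
    have u: "u \<in> {0..u + 1} - {}" "finite {}" using that by auto
    have "isCont g u" using cont that by (simp add: continuous_on_eq_continuous_at)
    then have "continuous (at u within {0..u + 1} - {}) g" by (rule continuous_at_imp_continuous_at_within)
    from integral_has_vector_derivative_continuous_at[OF int u this]
    have "(G has_vector_derivative g u) (at u within {0..u + 1})" by (simp add: G_def)
    moreover have "at u within {0..u + 1} = at u" using that by (intro at_within_Icc_at) auto
    ultimately show ?thesis by simp
  qed
  have parts: "integral {0..T} (\<lambda>u. ?e u * g u) = ?e T * G T + z * integral {0..T} (\<lambda>u. ?e u * G u)" if "T \<ge> 0" for T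
  proof -
    have "((\<lambda>u. ?e u * g u - z * (?e u * G u)) has_integral (?e T * G T - ?e 0 * G 0)) {0..T}"
    proof (rule fundamental_theorem_of_calculus_interior[OF that])
      show "continuous_on {0..T} (\<lambda>u. ?e u * G u)"
        using contG by (intro continuous_intros) (auto elim: continuous_on_subset)
      show "((\<lambda>u. ?e u * G u) has_vector_derivative ?e u * g u - z * (?e u * G u)) (at u)" if "u \<in> {0<..<T}" for u
      proof -
        have "(?e has_vector_derivative - z * ?e u) (at u)"
          by (rule has_vector_derivative_exp_minus)
        from has_vector_derivative_mult[OF this derG[of u]] that show ?thesis
          by (simp add: algebra_simps)
      qed
    qed
    moreover have "G 0 = 0" by (simp add: G_def)
    moreover have "((\<lambda>u. ?e u * G u) has_integral integral {0..T} (\<lambda>u. ?e u * G u)) {0..T}"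
      using contG by (intro integrable_integral integrable_continuous_interval continuous_intros)
         (auto elim: continuous_on_subset)
    ultimately have "((\<lambda>u. (?e u * g u - z * (?e u * G u)) + z * (?e u * G u)) has_integral
        (?e T * G T + z * integral {0..T} (\<lambda>u. ?e u * G u))) {0..T}"
      by (intro has_integral_add has_integral_mult_right) simp_all
    then show ?thesis by (simp add: integral_unique)
  qed
  have "((\<lambda>T. ?e T * G T) \<longlongrightarrow> 0) at_top"
  proof (rule Lim_null_comparison)
    show "\<forall>\<^sub>F T in at_top. norm (?e T * G T) \<le> exp (- Re z * T) * M"
      using bound by (intro eventually_at_top_linorderI[of 0]) (simp add: norm_mult)
    have "((\<lambda>T. exp (- Re z * T) * M) \<longlongrightarrow> 0 * M) at_top"
      using z by (intro tendsto_intros filterlim_compose[OF exp_at_bot]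
            filterlim_tendsto_neg_mult_at_bot[OF tendsto_const] filterlim_ident) auto
    then show "((\<lambda>T. exp (- Re z * T) * M) \<longlongrightarrow> 0) at_top" by simp
  qed
  moreover have "((\<lambda>T. integral {0..T} (\<lambda>u. ?e u * G u)) \<longlongrightarrow> integral {0..} (\<lambda>u. ?e u * G u)) at_top"
    using laplace_bounded[OF contG bound z]
    by (intro integral_initial_segments_tendsto set_lebesgue_integral_eq_integral(1))
  ultimately have "((\<lambda>T. ?e T * G T + z * integral {0..T} (\<lambda>u. ?e u * G u))
      \<longlongrightarrow> 0 + z * integral {0..} (\<lambda>u. ?e u * G u)) at_top"
    by (intro tendsto_intros)
  moreover have "\<forall>\<^sub>F T in at_top. ?e T * G T + z * integral {0..T} (\<lambda>u. ?e u * G u)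
                   = integral {0..T} (\<lambda>u. ?e u * g u)"
    using parts by (intro eventually_at_top_linorderI[of 0]) simp
  ultimately have "((\<lambda>T. integral {0..T} (\<lambda>u. ?e u * g u)) \<longlongrightarrow> 0 + z * integral {0..} (\<lambda>u. ?e u * G u)) at_top"
    by (rule Lim_transform_eventually)
  from tendsto_unique[OF trivial_limit_at_top_linorder integral_initial_segments_tendsto[OF zint] this]
  show ?thesis by simp
qed

text \<open>
  Convergence at \<open>s\<close>, however weak, makes the transform holomorphic to the right of \<open>s\<close> and continuous
  up to \<open>s\<close> along the ray. The values at other points are tied to the transform only where it is known to
  converge; this is enough, since for large real arguments the kernel is absolutely integrable.
\<close>

lemma laplace_analytic_continuation:
  fixes f :: "real \<Rightarrow> complex" and s :: complex
  assumes cont: "continuous_on {0<..} f" and s: "Re s > 0"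
    and int: "laplace_integrand f s integrable_on {0..}"
  obtains H where "H holomorphic_on {z. Re z > Re s}"
    and "\<And>z. Re z > Re s \<Longrightarrow> laplace_integrand f z integrable_on {0..} \<Longrightarrow> H z = laplace f z"
    and "(\<lambda>n. H (of_real (1 + 1 / real (Suc n)) * s)) \<longlonglongrightarrow> laplace f s"
proof -
  define g where "g = laplace_integrand f s"
  define G where "G = (\<lambda>t. integral {0..t} g)"
  have int_g: "g integrable_on {0..T}" for T
    using int by (auto simp: g_def intro: integrable_on_subinterval)
  have contg: "continuous_on {0<..} g"
    unfolding g_def laplace_integrand_def by (intro continuous_intros cont)
  have contG: "continuous_on {0..} G"
    unfolding G_def using int_g by (rule continuous_on_indefinite_integral_halfline)
  have limG: "(G \<longlongrightarrow> laplace f s) at_top"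
    unfolding G_def laplace_def g_def by (rule integral_initial_segments_tendsto[OF int])
  obtain M where bound: "\<And>t. t \<ge> 0 \<Longrightarrow> norm (G t) \<le> M"
  proof -
    have "\<forall>\<^sub>F t in at_top. dist (G t) (laplace f s) < 1" using limG by (rule tendstoD) simp
    then obtain T where T: "\<And>t. t \<ge> T \<Longrightarrow> dist (G t) (laplace f s) < 1"
      by (auto simp: eventually_at_top_linorder)
    have "compact (G ` {0..T})"
      using contG by (intro compact_continuous_image) (auto elim: continuous_on_subset)
    then obtain B where B: "\<And>t. t \<in> {0..T} \<Longrightarrow> norm (G t) \<le> B"
      by (meson bounded_iff compact_imp_bounded image_eqI)
    have "norm (G t) \<le> max B (1 + norm (laplace f s))" if "t \<ge> 0" for t
    proof (cases "t \<le> T")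
      case True
      then show ?thesis using B[of t] that by simp
    next
      case False
      then have "norm (G t - laplace f s) < 1" using T[of t] by (simp add: dist_norm)
      then show ?thesis using norm_triangle_sub[of "G t" "laplace f s"] by linarith
    qed
    then show ?thesis by (rule that)
  qed
  define K where "K = (\<lambda>w. integral {0..} (\<lambda>u. exp (- w * of_real u) * G u))"
  have holK: "K holomorphic_on {z. Re z > 0}"
    unfolding K_def using contG bound by (rule holomorphic_laplace_bounded)
  show ?thesis
  proof (rule that[of "\<lambda>z. (z - s) * K (z - s)"])
    have "(K \<circ> (\<lambda>z. z - s)) holomorphic_on {z. Re z > Re s}"
      by (rule holomorphic_on_compose_gen[OF _ holK]) (auto intro!: holomorphic_intros)
    then show "(\<lambda>z. (z - s) * K (z - s)) holomorphic_on {z. Re z > Re s}"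
      unfolding o_def by (intro holomorphic_intros)
    show "(z - s) * K (z - s) = laplace f z"
      if z: "Re z > Re s" and "laplace_integrand f z integrable_on {0..}" for z
    proof -
      have eq: "laplace_integrand f z = (\<lambda>u. exp (- (z - s) * of_real u) * g u)"
        by (simp add: fun_eq_iff g_def laplace_integrand_def exp_add [symmetric] algebra_simps
              flip: mult.assoc)
      have "integral {0..} (\<lambda>u. exp (- (z - s) * of_real u) * g u) = (z - s) * K (z - s)"
        unfolding K_def G_def
      proof (rule laplace_by_parts[OF contg int_g])
        show "norm (integral {0..t} g) \<le> M" if "t \<ge> 0" for t
          using bound[OF that] by (simp add: G_def)
        show "Re (z - s) > 0" using z by simp
        show "(\<lambda>u. exp (- (z - s) * of_real u) * g u) integrable_on {0..}"
          using that unfolding eq by simp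
      qed
      then show ?thesis by (simp only: laplace_def eq)
    qed
    have "of_real (1 + 1 / real (Suc n)) * s - s = s / of_real (real (Suc n))" for n
      by (simp add: ring_distribs del: of_nat_Suc)
    then show "(\<lambda>n. (of_real (1 + 1 / real (Suc n)) * s - s) * K (of_real (1 + 1 / real (Suc n)) * s - s))
            \<longlonglongrightarrow> laplace f s"
      using abel_limit_laplace[OF contG bound limG s] by (simp only: K_def)
  qed
qed

section \<open>Continuation to the whole region of convergence\<close>

text \<open>
  The identity theorem in the form needed below: agreement on a real half-line, where the transform has been
  computed, spreads to every domain that contains a right half-plane.
\<close>

lemma holomorphic_eq_if_eq_on_halfline:
  fixes A B :: "complex \<Rightarrow> complex"
  assumes "A holomorphic_on C" "B holomorphic_on C" "open C" "connected C"
    and half: "\<And>z. Re z > X \<Longrightarrow> z \<in> C"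
    and eq: "\<And>x. x > X \<Longrightarrow> A (of_real x) = B (of_real x)" and z: "z \<in> C"
  shows "A z = B z"
proof -
  have "complex_of_real (X + 1) islimpt (of_real ` {X<..})"
    unfolding islimpt_approachable
  proof (intro allI impI)
    fix e :: real assume "e > 0"
    then show "\<exists>x'\<in>complex_of_real ` {X<..}. x' \<noteq> of_real (X + 1) \<and> dist x' (of_real (X + 1)) < e"
      by (intro bexI[of _ "of_real (X + 1 + e / 2)"])
         (auto simp: dist_norm simp flip: of_real_diff of_real_add intro!: imageI)
  qed
  then have "A z - B z = 0"
    by (rule analytic_continuation[where f = "\<lambda>z. A z - B z" and S = C and \<xi> = "of_real (X + 1)", rotated 5])
       (use assms in \<open>auto intro!: holomorphic_intros\<close>)
  then show ?thesis by simp
qed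

text \<open>
  Multiplied out with both \<open>nat m\<close> and \<open>nat (- m)\<close>, of which at least one is \<open>0\<close>, so that both signs of the exponent
  are treated at once and no negative power is left.
\<close>

lemma powr_minus_of_int_mult_power:
  fixes w :: complex
  assumes "w \<noteq> 0"
  shows "w powr (- of_int m) * w ^ nat m = w ^ nat (- m)"
proof (cases "m \<ge> 0")
  case True
  then obtain n where "m = int n" by (rule nonneg_int_cases)
  then show ?thesis using assms by (simp add: powr_minus powr_nat')
next
  case False
  then obtain n where "m = - int n" by (metis nle_le nonpos_int_cases)
  then show ?thesis using assms by (simp add: powr_nat')
qed

text \<open>
  A complex exponent changes the modulus of \<open>z powr a\<close> only by the factor \<open>exp (- Im a * Arg z)\<close>, which is
  at least \<open>exp (- \<bar>Im a\<bar> * pi)\<close>.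
\<close>

lemma eventually_norm_divide_powr_less:
  fixes w a :: complex
  assumes a: "Re a > 0" and e: "e > 0"
  shows "\<forall>\<^sub>F r in at_top. \<forall>z. Re z \<ge> r \<longrightarrow> norm (w / z powr a) < e"
proof -
  let ?c = "norm w * exp (\<bar>Im a\<bar> * pi)"
  have "((\<lambda>r. ?c * r powr (- Re a)) \<longlongrightarrow> ?c * 0) at_top"
    by (intro tendsto_intros tendsto_neg_powr filterlim_ident) (use a in auto)
  then have "\<forall>\<^sub>F r in at_top. ?c * r powr (- Re a) < e"
    using e by (intro order_tendstoD(2)) auto
  then show ?thesis
    using eventually_gt_at_top[of 0]
  proof eventually_elim
    case (elim r)
    show ?case
    proof (intro allI impI)
      fix z assume "Re z \<ge> r"
      then have z: "norm z \<ge> r" "z \<noteq> 0" using elim complex_Re_le_cmod[of z] by auto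
      have "\<bar>Im a * Im (Ln z)\<bar> \<le> \<bar>Im a\<bar> * pi"
        unfolding abs_mult using z mpi_less_Im_Ln[of z] Im_Ln_le_pi[of z] by (intro mult_left_mono) auto
      then have "Im a * Im (Ln z) \<le> \<bar>Im a\<bar> * pi" by linarith
      moreover have "Re a * ln r \<le> Re a * ln (norm z)" using z a elim by simp
      moreover have "norm (w / z powr a) = norm w * exp (- (Re a * ln (norm z) - Im a * Im (Ln z)))"
        using z by (simp add: powr_def norm_divide exp_diff)
      ultimately have "norm (w / z powr a) \<le> norm w * exp (\<bar>Im a\<bar> * pi + - Re a * ln r)"
        by (auto intro!: mult_left_mono)
      also have "\<dots> = ?c * r powr (- Re a)"
        using elim by (simp only: exp_add) (simp add: powr_def)
      finally show "norm (w / z powr a) < e" using elim by linarith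
    qed
  qed
qed

context mittag_leffler
begin

lemma holomorphic_symbol: "symbol holomorphic_on {z. Re z > 0}"
  unfolding laplace_symbol_def [abs_def]
  by (auto intro!: holomorphic_intros simp: complex_nonpos_Reals_iff)

lemma eventually_Re_symbol_pos:
  "\<forall>\<^sub>F r in at_top. \<forall>z. Re z \<ge> r \<longrightarrow> Re (symbol z) > 0"
proof -
  have half: "(0::real) < 1 / 2" by simp
  show ?thesis
    using eventually_norm_divide_powr_less[OF Re_\<alpha> half, of \<omega>\<^sub>1]
      eventually_norm_divide_powr_less[OF Re_\<beta> half, of \<omega>\<^sub>2]
  proof eventually_elim
    case (elim r)
    show ?case
    proof (intro allI impI)
      fix z assume "Re z \<ge> r"
      then have "norm (\<omega>\<^sub>1 / z powr \<alpha>) < 1 / 2" "norm (\<omega>\<^sub>2 / z powr \<beta>) < 1 / 2" using elim by auto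
      then show "Re (symbol z) > 0"
        using complex_Re_le_cmod[of "\<omega>\<^sub>1 / z powr \<alpha>"] complex_Re_le_cmod[of "\<omega>\<^sub>2 / z powr \<beta>"]
        by (simp add: laplace_symbol_def)
    qed
  qed
qed

lemma kernel_absolutely_integrable:
  assumes "admissible (Re s)"
  shows "laplace_integrand kernel s absolutely_integrable_on {0..}"
proof -
  have "laplace_integrand kernel s absolutely_integrable_on {0<..}"
  proof (rule measurable_bounded_by_integrable_imp_absolutely_integrable)
    show "laplace_integrand kernel s \<in> borel_measurable (lebesgue_on {0<..})"
      unfolding laplace_integrand_def [abs_def]
      by (intro continuous_imp_measurable_on_sets_lebesgue continuous_intros continuous_on_kernel) auto
    show "(\<lambda>t. norm (of_real (exp (- Re s * t)) * kernel t)) integrable_on {0<..}"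
      using laplace_kernel_admissible(1)[OF assms] unfolding absolutely_integrable_on_def by blast
    show "norm (laplace_integrand kernel s t) \<le> norm (of_real (exp (- Re s * t)) * kernel t)" for t
      by (simp add: laplace_integrand_def norm_mult)
  qed simp
  then show ?thesis
    by (rule absolutely_integrable_spike_set) (auto intro: negligible_subset[of "{0}"])
qed

lemma laplace_kernel_real:
  assumes "admissible x"
  shows "laplace kernel (of_real x) = of_real x powr (- \<gamma>) * symbol (of_real x) powr (- \<delta>)"
proof -
  have "laplace_integrand kernel (of_real x) = (\<lambda>t. of_real (exp (- x * t)) * kernel t)"
    by (simp add: fun_eq_iff laplace_integrand_def exp_of_real [symmetric])
  then have "laplace kernel (of_real x) = integral {0<..} (\<lambda>t. of_real (exp (- x * t)) * kernel t)"
    by (simp only: laplace_def integral_open_halfline)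
  also have "\<dots> = 1 / of_real x powr \<gamma> * symbol (of_real x) powr (- \<delta>)"
    by (rule laplace_kernel_admissible(2)[OF assms])
  finally show ?thesis by (simp add: powr_minus divide_inverse)
qed

text \<open>
  In both cases the formula is transported from large real arguments to the points
  \<open>(1 + 1 / (n + 1)) * s\<close> of the ray, and then to \<open>s\<close> itself by passing to the limit.
\<close>

lemma laplace_kernel:
  assumes s: "Re s > 0" and int: "laplace_integrand kernel s integrable_on {0..}"
    and defined: "symbol_power_defined \<alpha> \<beta> \<delta> \<omega>\<^sub>1 \<omega>\<^sub>2 s"
  shows "laplace kernel s = s powr (- \<gamma>) * symbol s powr (- \<delta>)"
proof -
  obtain H where holH: "H holomorphic_on {z. Re z > Re s}"
    and H_eq: "\<And>z. Re z > Re s \<Longrightarrow> laplace_integrand kernel z integrable_on {0..} \<Longrightarrow> H z = laplace kernel z"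
    and H_lim: "(\<lambda>n. H (of_real (1 + 1 / real (Suc n)) * s)) \<longlonglongrightarrow> laplace kernel s"
    using laplace_analytic_continuation[OF continuous_on_kernel s int] by blast
  have "\<forall>\<^sub>F r in at_top. admissible r \<and> (\<forall>z. Re z \<ge> r \<longrightarrow> Re (symbol z) > 0) \<and> r \<ge> Re s"
    using eventually_admissible eventually_Re_symbol_pos eventually_ge_at_top[of "Re s"]
    by eventually_elim simp
  then obtain X where X: "\<And>r. r \<ge> X \<Longrightarrow> admissible r"
    "\<And>z. Re z \<ge> X \<Longrightarrow> Re (symbol z) > 0" "X \<ge> Re s"
    by (auto simp: eventually_at_top_linorder)
  have H_real: "H (of_real x) = of_real x powr (- \<gamma>) * symbol (of_real x) powr (- \<delta>)" if "x > X" for x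
  proof -
    have "laplace_integrand kernel (of_real x) integrable_on {0..}"
      using that X(1) by (intro set_lebesgue_integral_eq_integral(1) kernel_absolutely_integrable) auto
    then show ?thesis using that X H_eq[of "of_real x"] by (simp add: laplace_kernel_real)
  qed
  let ?z = "\<lambda>n. of_real (1 + 1 / real (Suc n)) * s"
  have z_lim: "?z \<longlonglongrightarrow> s"
  proof -
    have "(\<lambda>n. complex_of_real (1 + 1 / real (Suc n)) * s) \<longlonglongrightarrow> of_real (1 + 0) * s"
      by (intro tendsto_intros LIMSEQ_inverse_real_of_nat[unfolded inverse_eq_divide])
    then show ?thesis by simp
  qed
  have z_Re: "Re (?z n) > Re s" for n
    using s by (simp add: ring_distribs del: of_nat_Suc)
  have "isCont symbol s"
    using holomorphic_on_imp_continuous_on[OF holomorphic_symbol] s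
    by (simp add: continuous_on_eq_continuous_at open_halfspace_Re_gt)
  then have symbol_lim: "(\<lambda>n. symbol (?z n)) \<longlonglongrightarrow> symbol s"
    using z_lim by (rule isCont_tendsto_compose)
  have s_slit: "s \<notin> \<real>\<^sub>\<le>\<^sub>0" using s by (simp add: complex_nonpos_Reals_iff)
  have powr_lim: "(\<lambda>n. ?z n powr (- \<gamma>)) \<longlonglongrightarrow> s powr (- \<gamma>)"
    using z_lim s_slit by (intro tendsto_powr_complex tendsto_const)
  have subset: "{z. Re z > Re s} \<subseteq> {z. Re z > 0}" using s by auto
  note hol_symbol = holomorphic_on_subset[OF holomorphic_symbol subset]
  have hol_powr: "(\<lambda>z. z powr (- \<gamma>)) holomorphic_on {z. Re z > Re s}"
    using s by (intro holomorphic_intros) (auto simp: complex_nonpos_Reals_iff)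
  from defined show ?thesis unfolding symbol_power_defined_def
  proof (elim disjE conjE)
    assume "\<delta> \<in> \<int>" and nz: "symbol s \<noteq> 0"
    then obtain m where m: "\<delta> = of_int m" by (auto elim: Ints_cases)
    have "H z * symbol z ^ nat m = z powr (- \<gamma>) * symbol z ^ nat (- m)" if "Re z > Re s" for z
    proof (rule holomorphic_eq_if_eq_on_halfline[where C = "{z. Re z > Re s}" and X = X
          and A = "\<lambda>z. H z * symbol z ^ nat m" and B = "\<lambda>z. z powr (- \<gamma>) * symbol z ^ nat (- m)"])
      fix x :: real assume x: "x > X"
      then have "symbol (of_real x) \<noteq> 0" using X(2)[of "of_real x"] by auto
      then show "H (of_real x) * symbol (of_real x) ^ nat m = of_real x powr (- \<gamma>) * symbol (of_real x) ^ nat (- m)"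
        unfolding H_real[OF x] m by (simp add: powr_minus_of_int_mult_power mult.assoc)
    qed (use that X(3) in \<open>auto intro!: holomorphic_intros holH hol_symbol hol_powr
           open_halfspace_Re_gt convex_connected convex_halfspace_Re_gt\<close>)
    then have "H (?z n) * symbol (?z n) ^ nat m = ?z n powr (- \<gamma>) * symbol (?z n) ^ nat (- m)" for n
      using z_Re by blast
    moreover have "(\<lambda>n. H (?z n) * symbol (?z n) ^ nat m) \<longlonglongrightarrow> laplace kernel s * symbol s ^ nat m"
      by (intro tendsto_mult tendsto_power H_lim symbol_lim)
    moreover have "(\<lambda>n. ?z n powr (- \<gamma>) * symbol (?z n) ^ nat (- m)) \<longlonglongrightarrow> s powr (- \<gamma>) * symbol s ^ nat (- m)"
      by (intro tendsto_mult tendsto_power powr_lim symbol_lim)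
    ultimately have "laplace kernel s * symbol s ^ nat m = s powr (- \<gamma>) * symbol s ^ nat (- m)"
      using LIMSEQ_unique by (simp only:)
    also have "\<dots> = s powr (- \<gamma>) * symbol s powr (- \<delta>) * symbol s ^ nat m"
      using powr_minus_of_int_mult_power[OF nz, of m] by (simp add: m)
    finally show ?thesis using nz by simp
  next
    assume ray: "\<forall>r\<ge>1. symbol (of_real r * s) \<notin> \<real>\<^sub>\<le>\<^sub>0"
    \<comment> \<open>D is the part of the half-plane where the principal power is holomorphic; the ray and the
        half-plane \<open>Re z > X\<close> lie in one component C of it.\<close>
    define D where "D = {z. Re z > Re s} \<inter> {z. symbol z \<notin> \<real>\<^sub>\<le>\<^sub>0}"
    define C where "C = connected_component_set D (of_real (X + 1))"
    have "open ({z. Re z > Re s} \<inter> symbol -` (- \<real>\<^sub>\<le>\<^sub>0))"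
      using holomorphic_on_imp_continuous_on[OF hol_symbol] closed_nonpos_Reals_complex
      by (intro continuous_open_preimage open_halfspace_Re_gt) auto
    then have "open D" by (simp add: D_def vimage_def Compl_eq)
    then have "open C" unfolding C_def by (rule open_connected_component)
    have CD: "C \<subseteq> D" unfolding C_def by (rule connected_component_subset)
    let ?ray = "(\<lambda>r. of_real r * s) ` {1<..}"
    let ?half = "{z. Re z > X}"
    obtain r\<^sub>0 where "r\<^sub>0 > 1" "r\<^sub>0 * Re s > X"
    proof (rule that[of "max 2 (X / Re s + 1)"])
      have "X < (X / Re s + 1) * Re s" using s by (simp add: field_simps)
      also have "\<dots> \<le> max 2 (X / Re s + 1) * Re s" using s by (intro mult_right_mono) auto
      finally show "X < max 2 (X / Re s + 1) * Re s" .
    qed simp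
    then have "of_real r\<^sub>0 * s \<in> ?ray \<inter> ?half" by auto
    moreover have "connected ?ray"
      by (intro connected_continuous_image continuous_intros connected_Ioi)
    moreover have "connected ?half"
      by (intro convex_connected convex_halfspace_Re_gt)
    ultimately have "connected (?ray \<union> ?half)" by (intro connected_Un) auto
    moreover have "?ray \<union> ?half \<subseteq> D"
    proof -
      have "of_real r * s \<in> D" if "r > 1" for r
        using that ray s by (auto simp: D_def)
      moreover have "z \<in> D" if "Re z > X" for z
        using that X(2)[of z] X(3) by (auto simp: D_def complex_nonpos_Reals_iff)
      ultimately show ?thesis by auto
    qed
    ultimately have sub: "?ray \<union> ?half \<subseteq> C"
      unfolding C_def by (intro connected_component_maximal) auto
    have C_slit: "symbol z \<notin> \<real>\<^sub>\<le>\<^sub>0" and C_Re: "Re z > Re s" if "z \<in> C" for z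
      using that CD by (auto simp: D_def)
    then have C_sub: "C \<subseteq> {z. Re z > Re s}" by auto
    have "H z = z powr (- \<gamma>) * symbol z powr (- \<delta>)" if "z \<in> C" for z
    proof (rule holomorphic_eq_if_eq_on_halfline[where C = C and X = X
          and A = H and B = "\<lambda>z. z powr (- \<gamma>) * symbol z powr (- \<delta>)"])
      show "H holomorphic_on C" using holH C_sub by (rule holomorphic_on_subset)
      show "(\<lambda>z. z powr (- \<gamma>) * symbol z powr (- \<delta>)) holomorphic_on C"
        by (rule holomorphic_on_mult[OF holomorphic_on_subset[OF hol_powr C_sub]])
           (intro holomorphic_on_powr holomorphic_on_subset[OF hol_symbol C_sub] holomorphic_on_const C_slit)
      show "connected C" unfolding C_def by (rule connected_connected_component)
    qed (use sub H_real that \<open>open C\<close> in auto)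
    moreover have "?z n \<in> C" for n
    proof -
      have "?z n \<in> ?ray" by (rule imageI) simp
      then show ?thesis using sub by blast
    qed
    ultimately have "(\<lambda>n. H (?z n)) = (\<lambda>n. ?z n powr (- \<gamma>) * symbol (?z n) powr (- \<delta>))" by blast
    moreover have "(\<lambda>n. ?z n powr (- \<gamma>) * symbol (?z n) powr (- \<delta>)) \<longlonglongrightarrow> s powr (- \<gamma>) * symbol s powr (- \<delta>)"
      using ray[rule_format, of 1] by (intro tendsto_mult powr_lim tendsto_powr_complex symbol_lim tendsto_const) auto
    ultimately show ?thesis using H_lim LIMSEQ_unique by (simp only:)
  qed
qed

lemma abscissa_of_absolute_convergence:
  "\<exists>\<sigma>\<ge>0. \<forall>s. Re s > \<sigma> \<longrightarrow>
      laplace_integrand kernel s absolutely_integrable_on {0..} \<and> symbol_power_defined \<alpha> \<beta> \<delta> \<omega>\<^sub>1 \<omega>\<^sub>2 s"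
proof -
  have "\<forall>\<^sub>F r in at_top. admissible r \<and> (\<forall>z. Re z \<ge> r \<longrightarrow> Re (symbol z) > 0) \<and> r \<ge> 0"
    using eventually_admissible eventually_Re_symbol_pos eventually_ge_at_top[of 0]
    by eventually_elim simp
  then obtain \<sigma> where \<sigma>: "\<And>r. r \<ge> \<sigma> \<Longrightarrow> admissible r"
    "\<And>z. Re z \<ge> \<sigma> \<Longrightarrow> Re (symbol z) > 0" "\<sigma> \<ge> 0"
    by (auto simp: eventually_at_top_linorder)
  have "symbol_power_defined \<alpha> \<beta> \<delta> \<omega>\<^sub>1 \<omega>\<^sub>2 s" if "Re s > \<sigma>" for s
    unfolding symbol_power_defined_def
  proof (intro disjI2 allI impI)
    fix r :: real assume "r \<ge> 1"
    then have "1 * Re s \<le> r * Re s" using that \<sigma>(3) by (intro mult_right_mono) auto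
    then have "Re (of_real r * s) \<ge> \<sigma>" using that by simp
    then have "Re (symbol (of_real r * s)) > 0" by (rule \<sigma>(2))
    then show "symbol (of_real r * s) \<notin> \<real>\<^sub>\<le>\<^sub>0" by (auto simp: complex_nonpos_Reals_iff)
  qed
  then show ?thesis
    using \<sigma> kernel_absolutely_integrable by (intro exI[of _ \<sigma>]) auto
qed

end

theorem theorem2p8:
  fixes \<alpha> \<beta> \<gamma> \<delta> \<omega>\<^sub>1 \<omega>\<^sub>2 :: complex
  assumes "Re \<alpha> > 0" and "Re \<beta> > 0" and "Re \<gamma> > 0"
  shows "(\<forall>s. Re s > 0 \<longrightarrow>
            laplace_integrand (mittag_leffler_kernel \<alpha> \<beta> \<gamma> \<delta> \<omega>\<^sub>1 \<omega>\<^sub>2) s integrable_on {0..} \<longrightarrow>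
            symbol_power_defined \<alpha> \<beta> \<delta> \<omega>\<^sub>1 \<omega>\<^sub>2 s \<longrightarrow>
            laplace (\<lambda>t. of_real t powr (\<gamma> - 1) *
                bivariate_mittag_leffler \<alpha> \<beta> \<gamma> \<delta> (\<omega>\<^sub>1 * of_real t powr \<alpha>) (\<omega>\<^sub>2 * of_real t powr \<beta>)) s
              = 1 / s powr \<gamma> * (1 - \<omega>\<^sub>1 / s powr \<alpha> - \<omega>\<^sub>2 / s powr \<beta>) powr (- \<delta>)) \<and>
         (\<exists>\<sigma>\<ge>0. \<forall>s. Re s > \<sigma> \<longrightarrow>
            laplace_integrand (mittag_leffler_kernel \<alpha> \<beta> \<gamma> \<delta> \<omega>\<^sub>1 \<omega>\<^sub>2) s
              absolutely_integrable_on {0..} \<and>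
            symbol_power_defined \<alpha> \<beta> \<delta> \<omega>\<^sub>1 \<omega>\<^sub>2 s)"
proof -
  interpret mittag_leffler \<alpha> \<beta> \<gamma> \<delta> \<omega>\<^sub>1 \<omega>\<^sub>2
    using assms by unfold_locales
  have kernel_eq: "(\<lambda>t. of_real t powr (\<gamma> - 1) *
      bivariate_mittag_leffler \<alpha> \<beta> \<gamma> \<delta> (\<omega>\<^sub>1 * of_real t powr \<alpha>) (\<omega>\<^sub>2 * of_real t powr \<beta>)) = kernel"
    by (simp add: fun_eq_iff mittag_leffler_kernel_def)
  show ?thesis
    unfolding kernel_eq
    using laplace_kernel abscissa_of_absolute_convergence
    by (simp add: laplace_symbol_def powr_minus divide_inverse)
qed

end
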